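(* Let $n,k,l,m$ be natural numbers satisfying $n,l\ge 4$, $1<k<n-1$, $1<m<l-1$ and $$m':=\min\{m,l-m\}\le \min\{k,n-k\}.$$ If ${\mathcal J}$ is the image of an isometric embedding of the Johnson graph $J(l,m)$ in the Grassmann graph $\Gamma_{k}(V)$, then one of the following possibilities is realized: (1) there exists an $(k-m')$-dimensional subspace $M\subset V$ and a $(2m')$-independent subset ${\mathcal X}$ of $[M\rangle_{k-m'+1}$ (the set of all $(k-m'+1)$-dimensional subspaces of $V$ containing $M$, viewed as a projective space) consisting of $l$ elements such that ${\mathcal J}$ is the set of all sums of $m'$ distinct elements of ${\mathcal X}$; (2) there exists a $(k+m')$-dimensional subspace $N\subset V$ and a $(2m')$-independent subset ${\mathcal Y}$ of $\langle N]_{k+m'-1}$ (the set of all $(k+m'-1)$-dimensional subspaces of $N$, viewed as a projective space) consisting of $l$ elements such that ${\mathcal J}$ is the set of all intersections of $m'$ distinct elements of ${\mathcal Y}$. Moreover, the image of every isometric embedding of $J(2m,m)$ in $\Gamma_{k}(V)$ is an apartment of a parabolic subspace $[M,N]_{k}$ with $\dim M=k-m$ and $\dim N=k+m$, where $[M,N]_k$ is the set of all $k$-dimensional subspaces $S$ with $M\subset S\subset N$, and an apartment of $[M,N]_k$ is the set of all $k$-dimensional subspaces spanned by subsets of a base $B$ of $V$ that contain $M$ and are contained in $N$, for a base $B$ such that $M$ and $N$ are spanned by subsets of $B$.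
   Context: $V$ is an $n$-dimensional left vector space over a division ring $R$ with $4\le n<\infty$. ${\mathcal G}_{k}(V)$ is the set of all $k$-dimensional subspaces of $V$, and $\Gamma_{k}(V)$ is the Grassmann graph on ${\mathcal G}_{k}(V)$ in which two subspaces are adjacent if their intersection is $(k-1)$-dimensional; its distance is $d_k(S,U)=k-\dim(S\cap U)$. The Johnson graph $J(l,m)$ has as vertices the $m$-element subsets of an $l$-element set, two being adjacent if they meet in $m-1$ elements. A set of points (resp. hyperplanes) of a projective space is called $t$-independent if every $t$-element subset of it is independent; in (1) this means the sum of any $2m'$ elements of ${\mathcal X}$ has dimension $k+m'$, and in (2) the intersection of any $2m'$ elements of ${\mathcal Y}$ has dimension $k-m'$. *)

theory Defs
  imports Main
begin

text \<open>The vector space V is the whole carrier type 'v, with left scalar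
multiplication sc by elements of a division ring 'r.\<close>

definition left_vector_space :: "('r::division_ring \<Rightarrow> 'v::ab_group_add \<Rightarrow> 'v) \<Rightarrow> bool" where
  "left_vector_space sc \<longleftrightarrow>
     (\<forall>a x y. sc a (x + y) = sc a x + sc a y) \<and>
     (\<forall>a b x. sc (a + b) x = sc a x + sc b x) \<and>
     (\<forall>a b x. sc a (sc b x) = sc (a * b) x) \<and>
     (\<forall>x. sc 1 x = x)"

definition lvs_span :: "('r::division_ring \<Rightarrow> 'v::ab_group_add \<Rightarrow> 'v) \<Rightarrow> 'v set \<Rightarrow> 'v set" where
  "lvs_span sc S = {(\<Sum>v\<in>T. sc (c v) v) | T c. finite T \<and> T \<subseteq> S}"

definition lvs_subspace :: "('r::division_ring \<Rightarrow> 'v::ab_group_add \<Rightarrow> 'v) \<Rightarrow> 'v set \<Rightarrow> bool" where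
  "lvs_subspace sc W \<longleftrightarrow> 0 \<in> W \<and> (\<forall>x\<in>W. \<forall>y\<in>W. x + y \<in> W) \<and> (\<forall>a. \<forall>x\<in>W. sc a x \<in> W)"

definition lvs_indep :: "('r::division_ring \<Rightarrow> 'v::ab_group_add \<Rightarrow> 'v) \<Rightarrow> 'v set \<Rightarrow> bool" where
  "lvs_indep sc S \<longleftrightarrow>
     (\<forall>T c. finite T \<and> T \<subseteq> S \<and> (\<Sum>v\<in>T. sc (c v) v) = 0 \<longrightarrow> (\<forall>v\<in>T. c v = 0))"

definition lvs_basis :: "('r::division_ring \<Rightarrow> 'v::ab_group_add \<Rightarrow> 'v) \<Rightarrow> 'v set \<Rightarrow> 'v set \<Rightarrow> bool" where
  "lvs_basis sc W B \<longleftrightarrow> B \<subseteq> W \<and> lvs_indep sc B \<and> lvs_span sc B = W"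

definition lvs_has_dim :: "('r::division_ring \<Rightarrow> 'v::ab_group_add \<Rightarrow> 'v) \<Rightarrow> 'v set \<Rightarrow> nat \<Rightarrow> bool" where
  "lvs_has_dim sc W d \<longleftrightarrow> (\<exists>B. lvs_basis sc W B \<and> finite B \<and> card B = d)"

definition lvs_dim :: "('r::division_ring \<Rightarrow> 'v::ab_group_add \<Rightarrow> 'v) \<Rightarrow> 'v set \<Rightarrow> nat" where
  "lvs_dim sc W = (LEAST d. lvs_has_dim sc W d)"

definition grass :: "('r::division_ring \<Rightarrow> 'v::ab_group_add \<Rightarrow> 'v) \<Rightarrow> nat \<Rightarrow> 'v set set" where
  "grass sc k = {S. lvs_subspace sc S \<and> lvs_has_dim sc S k}"

definition grass_dist :: "('r::division_ring \<Rightarrow> 'v::ab_group_add \<Rightarrow> 'v) \<Rightarrow> nat \<Rightarrow> 'v set \<Rightarrow> 'v set \<Rightarrow> nat" where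
  "grass_dist sc k S U = k - lvs_dim sc (S \<inter> U)"

definition lvs_sum :: "('r::division_ring \<Rightarrow> 'v::ab_group_add \<Rightarrow> 'v) \<Rightarrow> 'v set set \<Rightarrow> 'v set" where
  "lvs_sum sc Ss = lvs_span sc (\<Union>Ss)"

definition is_walk :: "('a \<Rightarrow> 'a \<Rightarrow> bool) \<Rightarrow> 'a set \<Rightarrow> 'a list \<Rightarrow> bool" where
  "is_walk adj Vs xs \<longleftrightarrow> xs \<noteq> [] \<and> set xs \<subseteq> Vs \<and> (\<forall>i. Suc i < length xs \<longrightarrow> adj (xs ! i) (xs ! Suc i))"

definition graph_dist :: "('a \<Rightarrow> 'a \<Rightarrow> bool) \<Rightarrow> 'a set \<Rightarrow> 'a \<Rightarrow> 'a \<Rightarrow> nat" where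
  "graph_dist adj Vs x y =
     (LEAST d. \<exists>xs. is_walk adj Vs xs \<and> hd xs = x \<and> last xs = y \<and> length xs = Suc d)"

definition johnson_vertices :: "nat \<Rightarrow> nat \<Rightarrow> nat set set" where
  "johnson_vertices l m = {A. A \<subseteq> {0..<l} \<and> card A = m}"

definition johnson_adj :: "nat \<Rightarrow> nat set \<Rightarrow> nat set \<Rightarrow> bool" where
  "johnson_adj m A B \<longleftrightarrow> card (A \<inter> B) = m - 1"

definition johnson_dist :: "nat \<Rightarrow> nat \<Rightarrow> nat set \<Rightarrow> nat set \<Rightarrow> nat" where
  "johnson_dist l m = graph_dist (johnson_adj m) (johnson_vertices l m)"

definition isometric_embedding ::
  "('r::division_ring \<Rightarrow> 'v::ab_group_add \<Rightarrow> 'v) \<Rightarrow> nat \<Rightarrow> nat \<Rightarrow> nat \<Rightarrow> (nat set \<Rightarrow> 'v set) \<Rightarrow> bool" where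
  "isometric_embedding sc k l m f \<longleftrightarrow>
     f ` johnson_vertices l m \<subseteq> grass sc k \<and>
     (\<forall>A\<in>johnson_vertices l m. \<forall>B\<in>johnson_vertices l m.
        grass_dist sc k (f A) (f B) = johnson_dist l m A B)"

text \<open>X (a set of (dim M + 1)-dimensional subspaces containing M) is t-independent
 in the projective space [M>: every t elements span a subspace of dimension dim M + t.\<close>
definition points_t_indep :: "('r::division_ring \<Rightarrow> 'v::ab_group_add \<Rightarrow> 'v) \<Rightarrow> 'v set \<Rightarrow> nat \<Rightarrow> 'v set set \<Rightarrow> bool" where
  "points_t_indep sc M t X \<longleftrightarrow>
     (\<forall>Y\<subseteq>X. card Y = t \<longrightarrow> lvs_has_dim sc (lvs_sum sc Y) (lvs_dim sc M + t))"

text \<open>Y (a set of hyperplanes of N) is t-independent in the projective space <N]: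
 any t elements intersect in a subspace of dimension dim N - t.\<close>
definition hyperplanes_t_indep :: "('r::division_ring \<Rightarrow> 'v::ab_group_add \<Rightarrow> 'v) \<Rightarrow> 'v set \<Rightarrow> nat \<Rightarrow> 'v set set \<Rightarrow> bool" where
  "hyperplanes_t_indep sc N t Y \<longleftrightarrow>
     (\<forall>Z\<subseteq>Y. card Z = t \<longrightarrow> lvs_has_dim sc (\<Inter>Z) (lvs_dim sc N - t))"

end

theory Submission
  imports Defs
begin

text \<open>Passing to complements we may assume that 2m does not exceed l. Two adjacent vertices of J(l, m)
  have two kinds of common neighbours, and a vertex of the one kind is at distance 2 from a vertex of
  the other kind. Hence, of their images, exactly one contains the intersection of the images of the
  two given vertices and exactly one lies in their sum. Propagating this along the graph, either all cliques
  of the form "all m-sets containing X" go to stars of the Grassmann graph, or they all go to tops.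

  In the first case the (m-1)-sets X get (k-1)-dimensional subspaces (the centres of these stars), and this
  is again an isometric embedding with the same property. Descending to m = 0 gives M, and m = 1
  gives the points. The argument uses only the rank function of a modular lattice, so the second
  case is the first one in the dual lattice. If l = 2m, complementation turns the second case into the first.\<close>

section \<open>Distance in Johnson graphs\<close>

text \<open>Two constants shape the argument. The inequality 2m \<le> l gives the descent enough
  room. The centres belonging to X and Y meet in at least the expected rank by a triangle
  inequality; the upper bound compares them with the images of X + a and Y + b for distinct a, b
  outside X \<union> Y, and |X \<union> Y| can be as large as 2(m - 1). The number 2m' in the
  independence claims is the size of the union of two disjoint vertices: their images meet in rank k
  - m', so by modularity they join in rank k + m', which is the rank of M plus 2m'.

  An apartment is built from points over M, so the case of tops needs an extra argument when l = 2m.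
  It works because the types of the two kinds of cliques are opposite: if all m-sets containing X go
  to a top, then all m-sets inside Z go to a star, and complementation exchanges these two kinds of
  cliques.\<close>

lemma johnson_verticesI: "A \<subseteq> {0..<l} \<Longrightarrow> card A = m \<Longrightarrow> A \<in> johnson_vertices l m"
  by (simp add: johnson_vertices_def)

lemma johnson_verticesD:
  assumes "A \<in> johnson_vertices l m"
  shows "A \<subseteq> {0..<l}" "card A = m" "finite A"
  using assms finite_subset[of A "{0..<l}"] by (simp_all add: johnson_vertices_def)

lemma johnson_vertices_insert:
  assumes "X \<in> johnson_vertices l m" "a \<in> {0..<l} - X"
  shows "insert a X \<in> johnson_vertices l (Suc m)"
  using assms johnson_verticesD[OF assms(1)] by (simp add: johnson_vertices_def)

lemma johnson_vertices_remove:
  assumes "Z \<in> johnson_vertices l (Suc m)" "a \<in> Z"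
  shows "Z - {a} \<in> johnson_vertices l m"
  using assms by (auto simp: johnson_vertices_def)

lemma johnson_vertices_swap:
  assumes "X \<in> johnson_vertices l m" "x \<in> X" "y \<in> {0..<l} - X"
  shows "insert y (X - {x}) \<in> johnson_vertices l m"
proof (cases m)
  case 0
  then show ?thesis using assms johnson_verticesD[OF assms(1)] by auto
next
  case (Suc q)
  then show ?thesis using assms johnson_vertices_remove[of X l q x]
      johnson_vertices_insert[of "X - {x}" l q y] by simp
qed

lemma johnson_vertices_fresh:
  assumes "finite X" "card X < l"
  obtains a where "a \<in> {0..<l} - X"
proof -
  have "\<not> {0..<l} \<subseteq> X" using assms card_mono[of X "{0..<l}"] by auto
  then show ?thesis using that by blast
qed

text \<open>X and Y have equal size, so X - Y and Y - X are empty together, and an exchange between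
  them shortens X - Y by one. Such exchanges are the steps of a shortest path to Y; this is the
  induction both for distances and for propagation along the graph.\<close>

lemma johnson_induct [consumes 2, case_names base step]:
  assumes "X \<in> johnson_vertices l m" and Y: "Y \<in> johnson_vertices l m" and "P Y"
    and step: "\<And>X x y. X \<in> johnson_vertices l m \<Longrightarrow> x \<in> X - Y \<Longrightarrow> y \<in> Y - X
                 \<Longrightarrow> P (insert y (X - {x})) \<Longrightarrow> P X"
  shows "P X"
  using assms(1)
proof (induction "card (X - Y)" arbitrary: X)
  case 0
  then have "X = Y"
    using johnson_verticesD[OF 0(2)] johnson_verticesD[OF Y] by (metis Diff_eq_empty_iff card_0_eq card_subset_eq finite_Diff)
  then show ?case using assms by simp
next
  case (Suc d)
  note X = johnson_verticesD[OF Suc(3)] and Y' = johnson_verticesD[OF Y]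
  obtain x where x: "x \<in> X - Y" using Suc(2) by (metis card.empty ex_in_conv nat.distinct(1))
  have "card (Y - X) = card (X - Y)"
    using X Y' by (simp add: card_Diff_subset_Int Int_commute)
  then obtain y where y: "y \<in> Y - X" using Suc(2) by (metis card.empty ex_in_conv nat.distinct(1))
  have "insert y (X - {x}) - Y = (X - Y) - {x}" using y by auto
  then have "card (insert y (X - {x}) - Y) = d" using x Suc(2) X by simp
  then have "P (insert y (X - {x}))"
    using Suc(1) johnson_vertices_swap[OF Suc(3)] x y Y' by fastforce
  then show ?case using step Suc(3) x y by blast
qed

lemma card_Int_swap:
  assumes "finite X" "x \<in> X - Y" "y \<in> Y - X"
  shows "card (insert y (X - {x}) \<inter> Y) = Suc (card (X \<inter> Y))"
proof -
  have "insert y (X - {x}) \<inter> Y = insert y (X \<inter> Y)" using assms by auto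
  then show ?thesis using assms by simp
qed

text \<open>Only one element of \<open>A\<close> can be missing from the adjacent set
  \<open>C\<close>, so one step of a walk loses at most one common element with
  \<open>B\<close>.\<close>

lemma card_Int_le_walk_step:
  assumes "finite A" "finite C" "card (A \<inter> C) = card A - 1"
  shows "card (A \<inter> B) \<le> Suc (card (C \<inter> B))"
proof -
  have "A \<inter> B \<subseteq> (C \<inter> B) \<union> (A - C)" by auto
  then have "card (A \<inter> B) \<le> card (C \<inter> B) + card (A - C)"
    by (metis assms(1,2) card_Un_le card_mono finite_Diff finite_Int finite_UnI le_trans)
  moreover have "card (A - C) \<le> 1"
    using assms by (simp add: card_Diff_subset_Int)
  ultimately show ?thesis by simp
qed

lemma johnson_walk_length:
  assumes "is_walk (johnson_adj m) (johnson_vertices l m) xs"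
  shows "m - card (hd xs \<inter> last xs) < length xs"
  using assms
proof (induction xs)
  case Nil
  then show ?case by (simp add: is_walk_def)
next
  case (Cons A ys)
  show ?case
  proof (cases ys)
    case Nil
    then show ?thesis using Cons(2) johnson_verticesD(2)[of A] by (auto simp: is_walk_def)
  next
    case (Cons C zs)
    have w: "is_walk (johnson_adj m) (johnson_vertices l m) ys"
      using Cons.prems Cons unfolding is_walk_def by auto
    have "A \<in> johnson_vertices l m" "C \<in> johnson_vertices l m" "johnson_adj m A C"
      using Cons.prems Cons unfolding is_walk_def by force+
    then have "card (C \<inter> last ys) \<le> Suc (card (A \<inter> last ys))"
      by (intro card_Int_le_walk_step)
        (auto simp: johnson_adj_def Int_commute johnson_verticesD)
    then show ?thesis using Cons.IH[OF w] Cons by simp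
  qed
qed

lemma johnson_walk_exists:
  assumes "A \<in> johnson_vertices l m" and B: "B \<in> johnson_vertices l m"
  shows "\<exists>xs. is_walk (johnson_adj m) (johnson_vertices l m) xs \<and> hd xs = A \<and> last xs = B
           \<and> length xs = Suc (m - card (A \<inter> B))"
  using assms
proof (induction rule: johnson_induct)
  case base
  then show ?case
    using johnson_verticesD[OF B] B by (intro exI[of _ "[B]"]) (auto simp: is_walk_def)
next
  case (step X x y)
  note X = johnson_verticesD[OF step(1)]
  let ?X = "insert y (X - {x})"
  from step obtain xs where xs: "is_walk (johnson_adj m) (johnson_vertices l m) xs" "hd xs = ?X"
    "last xs = B" "length xs = Suc (m - card (?X \<inter> B))" by blast
  have "X \<inter> ?X = X - {x}" using step by auto
  then have adj: "johnson_adj m X ?X" using step X by (simp add: johnson_adj_def)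
  have ne: "xs \<noteq> []" using xs by (auto simp: is_walk_def)
  \<comment> \<open>Subtraction of naturals truncates, so strictness is needed for the distance to
    drop by exactly one.\<close>
  have "X \<inter> B \<subset> X" using step by auto
  then have "card (X \<inter> B) < m" using X psubset_card_mono by blast
  then have "length (X # xs) = Suc (m - card (X \<inter> B))"
    using xs card_Int_swap[OF X(3) step(2,3)] by simp
  moreover have "is_walk (johnson_adj m) (johnson_vertices l m) (X # xs)"
    using xs(1,2) adj step(1) ne unfolding is_walk_def
    by (auto simp: nth_Cons hd_conv_nth split: nat.split)
  ultimately show ?case using xs ne by (intro exI[of _ "X # xs"]) auto
qed

lemma johnson_dist_eq:
  assumes "A \<in> johnson_vertices l m" "B \<in> johnson_vertices l m"
  shows "johnson_dist l m A B = m - card (A \<inter> B)"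
  unfolding johnson_dist_def graph_dist_def
proof (rule Least_equality)
  show "\<exists>xs. is_walk (johnson_adj m) (johnson_vertices l m) xs \<and> hd xs = A \<and> last xs = B
           \<and> length xs = Suc (m - card (A \<inter> B))"
    using johnson_walk_exists assms by blast
next
  fix d assume "\<exists>xs. is_walk (johnson_adj m) (johnson_vertices l m) xs \<and> hd xs = A \<and> last xs = B
           \<and> length xs = Suc d"
  then show "m - card (A \<inter> B) \<le> d" using johnson_walk_length by fastforce
qed

section \<open>Isometric maps into modular lattices\<close>

text \<open>Ranks are integers so that \<open>- rk\<close> is a rank function of the opposite
  lattice. Antisymmetry is contained in \<open>rk_mono\<close> and \<open>eq_if_rk\<close>. The
  carrier \<open>L\<close> is a set because subspaces are only some of the sets of vectors.\<close>

locale ranked_modular_lattice =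
  fixes L :: "'a set"
    and le :: "'a \<Rightarrow> 'a \<Rightarrow> bool" (infix \<open>\<sqsubseteq>\<close> 50)
    and meet :: "'a \<Rightarrow> 'a \<Rightarrow> 'a" (infixl \<open>\<sqinter>\<close> 70)
    and join :: "'a \<Rightarrow> 'a \<Rightarrow> 'a" (infixl \<open>\<squnion>\<close> 65)
    and rk :: "'a \<Rightarrow> int"
  assumes refl: "x \<in> L \<Longrightarrow> x \<sqsubseteq> x"
    and trans: "x \<in> L \<Longrightarrow> y \<in> L \<Longrightarrow> z \<in> L \<Longrightarrow> x \<sqsubseteq> y \<Longrightarrow> y \<sqsubseteq> z \<Longrightarrow> x \<sqsubseteq> z"
    and meet_closed: "x \<in> L \<Longrightarrow> y \<in> L \<Longrightarrow> x \<sqinter> y \<in> L"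
    and join_closed: "x \<in> L \<Longrightarrow> y \<in> L \<Longrightarrow> x \<squnion> y \<in> L"
    and meet_le: "x \<in> L \<Longrightarrow> y \<in> L \<Longrightarrow> x \<sqinter> y \<sqsubseteq> x" "x \<in> L \<Longrightarrow> y \<in> L \<Longrightarrow> x \<sqinter> y \<sqsubseteq> y"
    and le_join: "x \<in> L \<Longrightarrow> y \<in> L \<Longrightarrow> x \<sqsubseteq> x \<squnion> y" "x \<in> L \<Longrightarrow> y \<in> L \<Longrightarrow> y \<sqsubseteq> x \<squnion> y"
    and meet_greatest: "x \<in> L \<Longrightarrow> y \<in> L \<Longrightarrow> z \<in> L \<Longrightarrow> z \<sqsubseteq> x \<Longrightarrow> z \<sqsubseteq> y \<Longrightarrow> z \<sqsubseteq> x \<sqinter> y"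
    and join_least: "x \<in> L \<Longrightarrow> y \<in> L \<Longrightarrow> z \<in> L \<Longrightarrow> x \<sqsubseteq> z \<Longrightarrow> y \<sqsubseteq> z \<Longrightarrow> x \<squnion> y \<sqsubseteq> z"
    and rk_mono: "x \<in> L \<Longrightarrow> y \<in> L \<Longrightarrow> x \<sqsubseteq> y \<Longrightarrow> rk x \<le> rk y"
    and eq_if_rk: "x \<in> L \<Longrightarrow> y \<in> L \<Longrightarrow> x \<sqsubseteq> y \<Longrightarrow> rk y \<le> rk x \<Longrightarrow> x = y"
    and rk_modular: "x \<in> L \<Longrightarrow> y \<in> L \<Longrightarrow> rk (x \<squnion> y) + rk (x \<sqinter> y) = rk x + rk y"
begin

lemma dual: "ranked_modular_lattice L (\<lambda>x y. y \<sqsubseteq> x) join meet (\<lambda>x. - rk x)"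
proof (standard, goal_cases)
  case (2 x y z)
  then show ?case using trans[of z y x] by simp
next
  case (11 x y)
  then show ?case using rk_mono by simp
next
  case (12 x y)
  then show ?case using eq_if_rk[of y x] by simp
next
  case (13 x y)
  then show ?case using rk_modular[of x y] by simp
qed (simp_all add: refl meet_closed join_closed meet_le le_join meet_greatest join_least)

section \<open>Adjacent elements and their common neighbours in a modular lattice\<close>

lemma meet_comm: "x \<in> L \<Longrightarrow> y \<in> L \<Longrightarrow> x \<sqinter> y = y \<sqinter> x"
  by (simp add: eq_if_rk rk_mono meet_greatest meet_closed meet_le)

lemma meet_idem: "x \<in> L \<Longrightarrow> x \<sqinter> x = x"
  by (simp add: eq_if_rk rk_mono meet_greatest meet_closed meet_le refl)

text \<open>On elements of one rank k, the number k - rk (x \<sqinter> y) is a distance, and this is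
  its triangle inequality. Both meets on the left lie below \<open>b\<close>, and their own meet
  lies below \<open>a \<sqinter> c\<close>; modularity compares the ranks.\<close>

lemma rk_meet_triangle:
  assumes "a \<in> L" "b \<in> L" "c \<in> L"
  shows "rk (a \<sqinter> b) + rk (b \<sqinter> c) \<le> rk (a \<sqinter> c) + rk b"
proof -
  let ?x = "a \<sqinter> b" and ?y = "b \<sqinter> c"
  have L: "?x \<in> L" "?y \<in> L" "?x \<sqinter> ?y \<in> L" "?x \<squnion> ?y \<in> L"
    using assms by (simp_all add: meet_closed join_closed)
  have "?x \<squnion> ?y \<sqsubseteq> b" using assms L by (simp add: join_least meet_le)
  moreover have "?x \<sqinter> ?y \<sqsubseteq> a" "?x \<sqinter> ?y \<sqsubseteq> c"
    using trans[OF L(3,1) assms(1) meet_le(1)[OF L(1,2)] meet_le(1)[OF assms(1,2)]]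
      trans[OF L(3,2) assms(3) meet_le(2)[OF L(1,2)] meet_le(2)[OF assms(2,3)]] by simp_all
  then have "?x \<sqinter> ?y \<sqsubseteq> a \<sqinter> c" using assms L by (simp add: meet_greatest)
  ultimately have "rk (?x \<squnion> ?y) \<le> rk b" "rk (?x \<sqinter> ?y) \<le> rk (a \<sqinter> c)"
    using assms L by (auto intro!: rk_mono meet_closed)
  then show ?thesis using rk_modular[OF L(1,2)] by simp
qed

text \<open>The elements \<open>a \<sqinter> c\<close> and \<open>b \<sqinter> c\<close> of rank k -
  1 both lie below \<open>c\<close>. If they differ, their join has rank k and is \<open>c\<close>;
  if they agree, they are also the meet of \<open>a\<close> and \<open>b\<close>. These are the
  cases of a top and of a star.\<close>

lemma adjacent_triple:
  assumes L: "a \<in> L" "b \<in> L" "c \<in> L" and rk: "rk a = k" "rk b = k" "rk c = k"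
    and adj: "rk (a \<sqinter> b) = k - 1" "rk (a \<sqinter> c) = k - 1" "rk (b \<sqinter> c) = k - 1"
  shows "a \<sqinter> b \<sqsubseteq> c \<or> c \<sqsubseteq> a \<squnion> b"
proof -
  let ?x = "a \<sqinter> c" and ?y = "b \<sqinter> c"
  have M: "?x \<in> L" "?y \<in> L" "a \<sqinter> b \<in> L" "?x \<sqinter> ?y \<in> L" "?x \<squnion> ?y \<in> L" "a \<squnion> b \<in> L"
    using L by (simp_all add: meet_closed join_closed)
  have le: "?x \<sqinter> ?y \<sqsubseteq> a" "?x \<sqinter> ?y \<sqsubseteq> b" "?x \<sqinter> ?y \<sqsubseteq> c"
    using trans[OF M(4,1) L(1) meet_le(1)[OF M(1,2)] meet_le(1)[OF L(1,3)]]
      trans[OF M(4,2) L(2) meet_le(2)[OF M(1,2)] meet_le(1)[OF L(2,3)]]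
      trans[OF M(4,1) L(3) meet_le(1)[OF M(1,2)] meet_le(2)[OF L(1,3)]] by simp_all
  have jc: "?x \<squnion> ?y \<sqsubseteq> c" using L M by (simp add: join_least meet_le)
  have "?x \<sqsubseteq> a \<squnion> b" "?y \<sqsubseteq> a \<squnion> b"
    using trans[OF M(1) L(1) M(6) meet_le(1)[OF L(1,3)] le_join(1)[OF L(1,2)]]
      trans[OF M(2) L(2) M(6) meet_le(1)[OF L(2,3)] le_join(2)[OF L(1,2)]] by simp_all
  then have jab: "?x \<squnion> ?y \<sqsubseteq> a \<squnion> b" using M by (simp add: join_least)
  have mab: "?x \<sqinter> ?y \<sqsubseteq> a \<sqinter> b" using L M le by (simp add: meet_greatest)
  show ?thesis
  proof (cases "rk (?x \<sqinter> ?y) \<le> k - 2")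
    case True
    then have "rk c \<le> rk (?x \<squnion> ?y)" using rk_modular[OF M(1,2)] adj rk by simp
    then have "?x \<squnion> ?y = c" using eq_if_rk[OF M(5) L(3) jc] by simp
    then show ?thesis using jab by simp
  next
    case False
    then have "?x \<sqinter> ?y = a \<sqinter> b" using eq_if_rk[OF M(4) M(3) mab] adj by simp
    then show ?thesis using le by simp
  qed
qed

text \<open>Comparable meets of equal rank coincide, so the centre of a star triple does not depend
  on the pair that defines it.\<close>

lemma adjacent_triple_rotate:
  assumes L: "a \<in> L" "b \<in> L" "c \<in> L"
    and adj: "rk (a \<sqinter> b) = rk (a \<sqinter> c)" and "a \<sqinter> b \<sqsubseteq> c"
  shows "a \<sqinter> c \<sqsubseteq> b"
proof -
  have "a \<sqinter> b \<sqsubseteq> a \<sqinter> c" using assms by (simp add: meet_greatest meet_le meet_closed)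
  then have "a \<sqinter> b = a \<sqinter> c" using L adj by (simp add: eq_if_rk meet_closed)
  then show ?thesis using L meet_le by metis
qed

text \<open>For adjacent \<open>a\<close>, \<open>b\<close> and for \<open>c\<close>,
  \<open>d\<close> at distance 2, the meet of \<open>c\<close> and \<open>d\<close> is too small to
  lie above that of \<open>a\<close> and \<open>b\<close>.\<close>

lemma not_both_above_meet:
  assumes "a \<in> L" "b \<in> L" "c \<in> L" "d \<in> L" "rk (c \<sqinter> d) < rk (a \<sqinter> b)" "a \<sqinter> b \<sqsubseteq> c"
  shows "\<not> a \<sqinter> b \<sqsubseteq> d"
proof
  assume "a \<sqinter> b \<sqsubseteq> d"
  then have "rk (a \<sqinter> b) \<le> rk (c \<sqinter> d)" using assms by (simp add: meet_closed meet_greatest rk_mono)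
  then show False using assms by simp
qed

text \<open>The assumed inequality says rk (a \<squnion> b) < rk (c \<squnion> d) in terms of meets.
  With all four of rank k, \<open>a\<close>, \<open>b\<close> adjacent and \<open>c\<close>,
  \<open>d\<close> at distance 2, these ranks are k + 1 and k + 2.\<close>

lemma not_both_below_join:
  assumes L: "a \<in> L" "b \<in> L" "c \<in> L" "d \<in> L" and "rk a + rk b < rk c + rk d + rk (a \<sqinter> b) - rk (c \<sqinter> d)"
    and "c \<sqsubseteq> a \<squnion> b"
  shows "\<not> d \<sqsubseteq> a \<squnion> b"
proof
  assume "d \<sqsubseteq> a \<squnion> b"
  then have "rk (c \<squnion> d) \<le> rk (a \<squnion> b)" using assms by (simp add: join_closed join_least rk_mono)
  then show False using rk_modular[OF L(1,2)] rk_modular[OF L(3,4)] assms by linarith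
qed

text \<open>Distances are recorded as integer ranks of meets, a form that survives passage to the
  dual. That all images have rank \<open>k\<close> is the case A = B.\<close>

definition isometric :: "nat \<Rightarrow> nat \<Rightarrow> int \<Rightarrow> (nat set \<Rightarrow> 'a) \<Rightarrow> bool" where
  "isometric l m k f \<longleftrightarrow>
     (\<forall>A\<in>johnson_vertices l m. f A \<in> L) \<and>
     (\<forall>A\<in>johnson_vertices l m. \<forall>B\<in>johnson_vertices l m.
        rk (f A \<sqinter> f B) = k - int m + int (card (A \<inter> B)))"

text \<open>The sets \<open>insert a X\<close> form a clique, and the condition sends it into a
  star. Read in the opposite order, the same formula sends it into a top.\<close>

definition star_triples_meet :: "nat \<Rightarrow> nat \<Rightarrow> (nat set \<Rightarrow> 'a) \<Rightarrow> bool" where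
  "star_triples_meet l p f \<longleftrightarrow>
     (\<forall>X\<in>johnson_vertices l p. \<forall>a\<in>{0..<l} - X. \<forall>b\<in>{0..<l} - X. \<forall>c\<in>{0..<l} - X.
        a \<noteq> b \<longrightarrow> a \<noteq> c \<longrightarrow> b \<noteq> c \<longrightarrow> f (insert a X) \<sqinter> f (insert b X) \<sqsubseteq> f (insert c X))"

text \<open>The word top refers to the clique in the Johnson graph, formed by the sets
  \<open>Z - {a}\<close>; its image is again required to lie in a star. Complementing index sets
  turns this condition into \<open>star_triples_meet\<close>.\<close>

definition top_triples_meet :: "nat \<Rightarrow> nat \<Rightarrow> (nat set \<Rightarrow> 'a) \<Rightarrow> bool" where
  "top_triples_meet l q f \<longleftrightarrow>
     (\<forall>Z\<in>johnson_vertices l q. \<forall>a\<in>Z. \<forall>b\<in>Z. \<forall>c\<in>Z.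
        a \<noteq> b \<longrightarrow> a \<noteq> c \<longrightarrow> b \<noteq> c \<longrightarrow> f (Z - {a}) \<sqinter> f (Z - {b}) \<sqsubseteq> f (Z - {c}))"

text \<open>A relation in place of an iterated join: in the opposite order it yields greatest lower
  bounds, so it serves both for sums of points and for intersections of hyperplanes.\<close>

definition lub :: "(nat \<Rightarrow> 'a) \<Rightarrow> nat set \<Rightarrow> 'a \<Rightarrow> bool" where
  "lub P A u \<longleftrightarrow> u \<in> L \<and> (\<forall>i\<in>A. P i \<sqsubseteq> u) \<and> (\<forall>w\<in>L. (\<forall>i\<in>A. P i \<sqsubseteq> w) \<longrightarrow> u \<sqsubseteq> w)"

lemma lub_join:
  assumes "lub P A u" "lub P B v" "P ` (A \<union> B) \<subseteq> L"
  shows "lub P (A \<union> B) (u \<squnion> v)"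
proof -
  have L: "u \<in> L" "v \<in> L" "u \<squnion> v \<in> L" using assms by (auto simp: lub_def join_closed)
  have "P i \<sqsubseteq> u \<squnion> v" if "i \<in> A \<union> B" for i
  proof -
    have "P i \<in> L" "P i \<sqsubseteq> u \<or> P i \<sqsubseteq> v" using that assms by (auto simp: lub_def)
    then show ?thesis using L trans[of "P i" _ "u \<squnion> v"] le_join[OF L(1,2)] by blast
  qed
  moreover have "u \<squnion> v \<sqsubseteq> w" if "w \<in> L" "\<forall>i\<in>A \<union> B. P i \<sqsubseteq> w" for w
    using that assms L unfolding lub_def by (simp add: join_least)
  ultimately show ?thesis using L by (simp add: lub_def)
qed

lemma isometric_closed: "isometric l m k f \<Longrightarrow> A \<in> johnson_vertices l m \<Longrightarrow> f A \<in> L"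
  by (simp add: isometric_def)

lemma isometric_rk:
  assumes "isometric l m k f" "A \<in> johnson_vertices l m"
  shows "rk (f A) = k"
proof -
  have "rk (f A \<sqinter> f A) = k" using assms johnson_verticesD[of A] by (simp add: isometric_def)
  then show ?thesis using isometric_closed[OF assms] by (simp add: meet_idem)
qed

lemma isometric_rk_meet:
  "isometric l m k f \<Longrightarrow> A \<in> johnson_vertices l m \<Longrightarrow> B \<in> johnson_vertices l m \<Longrightarrow>
    rk (f A \<sqinter> f B) = k - int m + int (card (A \<inter> B))"
  by (simp add: isometric_def)

section \<open>Descent from m-sets to points\<close>

lemma isometric_star_rk:
  assumes "isometric l (Suc p) k f" "X \<in> johnson_vertices l p"
    "a \<in> {0..<l} - X" "b \<in> {0..<l} - X" "a \<noteq> b"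
  shows "rk (f (insert a X) \<sqinter> f (insert b X)) = k - 1"
proof -
  have "insert a X \<inter> insert b X = X" using assms by auto
  then show ?thesis
    using isometric_rk_meet[OF assms(1)] johnson_vertices_insert[OF assms(2)] assms
      johnson_verticesD[OF assms(2)] by simp
qed

text \<open>Each descent lowers the size of the index sets and the rank by one, so their difference
  is invariant: this is the rank of \<open>M\<close>, and the points have one more.\<close>

lemma star_structure:
  assumes "isometric l (Suc p) k f" "star_triples_meet l p f" "2 * Suc p \<le> l"
  shows "\<exists>M P. M \<in> L \<and> rk M = k - int (Suc p) \<and>
    (\<forall>i<l. P i \<in> L \<and> M \<sqsubseteq> P i \<and> rk (P i) = k - int p) \<and>
    (\<forall>A\<in>johnson_vertices l (Suc p). lub P A (f A))"
  using assms
proof (induction p arbitrary: k f)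
  case 0
  have V: "{i} \<in> johnson_vertices l (Suc 0)" if "i < l" for i
    using that by (auto simp: johnson_vertices_def)
  have E: "{} \<in> johnson_vertices l 0" by (auto simp: johnson_vertices_def)
  have L: "f {i} \<in> L" if "i < l" for i using isometric_closed[OF 0(1) V[OF that]] .
  \<comment> \<open>Over the empty set all points form one star, so two of them already determine
    its centre.\<close>
  let ?M = "f {0} \<sqinter> f {1}"
  have M_L: "?M \<in> L" using L 0 by (simp add: meet_closed)
  have "?M \<sqsubseteq> f {i}" if i: "i < l" for i
  proof (cases "i = 0 \<or> i = 1")
    case True
    then show ?thesis using meet_le[of "f {0}" "f {1}"] L 0 by auto
  next
    case False
    then show ?thesis using bspec[OF 0(2)[unfolded star_triples_meet_def] E] i by simp
  qed
  moreover have "rk ?M = k - 1"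
    using isometric_star_rk[OF 0(1) E, of 0 1] 0 by simp
  moreover have "rk (f {i}) = k" if "i < l" for i
    using isometric_rk[OF 0(1) V[OF that]] .
  moreover have "lub (\<lambda>i. f {i}) A (f A)" if "A \<in> johnson_vertices l (Suc 0)" for A
  proof -
    from johnson_verticesD(1,2)[OF that] obtain i where "A = {i}" "i < l"
      by (metis One_nat_def card_1_singletonE atLeastLessThan_iff insert_subset)
    then show ?thesis using L by (auto simp: lub_def intro: refl)
  qed
  ultimately show ?case
    using M_L L by (intro exI[of _ ?M] exI[of _ "\<lambda>i. f {i}"]) auto
next
  case (Suc p)
  note iso = Suc.prems(1) and star = Suc.prems(2) and l = Suc.prems(3)
  note ins = johnson_vertices_insert
  have fL: "f (insert a X) \<in> L" "rk (f (insert a X)) = k"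
    if "X \<in> johnson_vertices l (Suc p)" "a \<in> {0..<l} - X" for a X
    using isometric_closed[OF iso ins[OF that]] isometric_rk[OF iso ins[OF that]] by auto
  have "\<exists>y. y \<in> L \<and> rk y = k - 1 \<and> (\<forall>a\<in>{0..<l} - X. y \<sqsubseteq> f (insert a X))"
    if X: "X \<in> johnson_vertices l (Suc p)" for X
  proof -
    note XD = johnson_verticesD[OF X]
    obtain a where a: "a \<in> {0..<l} - X" using johnson_vertices_fresh[of X l] XD l by auto
    obtain b where "b \<in> {0..<l} - insert a X"
      using johnson_vertices_fresh[of "insert a X" l] XD l a by auto
    then have b: "b \<in> {0..<l} - X" "a \<noteq> b" by auto
    let ?y = "f (insert a X) \<sqinter> f (insert b X)"
    have "?y \<sqsubseteq> f (insert c X)" if c: "c \<in> {0..<l} - X" for c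
    proof (cases "c = a \<or> c = b")
      case True
      then show ?thesis using meet_le[OF fL(1)[OF X a] fL(1)[OF X b(1)]] by auto
    next
      case False
      then show ?thesis using star X a b c unfolding star_triples_meet_def by auto
    qed
    then show ?thesis
      using isometric_star_rk[OF iso X a b] meet_closed[OF fL(1)[OF X a] fL(1)[OF X b(1)]] by blast
  qed
  then obtain h where h: "\<And>X. X \<in> johnson_vertices l (Suc p) \<Longrightarrow> h X \<in> L"
    "\<And>X. X \<in> johnson_vertices l (Suc p) \<Longrightarrow> rk (h X) = k - 1"
    "\<And>X a. X \<in> johnson_vertices l (Suc p) \<Longrightarrow> a \<in> {0..<l} - X \<Longrightarrow> h X \<sqsubseteq> f (insert a X)"
    by metis
  \<comment> \<open>For sets that differ by one exchange, both centres lie below the image of their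
    union, which has rank k. By modularity two such elements of rank k - 1 meet in rank at least k -
    2.\<close>
  have h_step: "k - 2 \<le> rk (h X \<sqinter> h (insert y (X - {x})))"
    if X: "X \<in> johnson_vertices l (Suc p)" and x: "x \<in> X" and y: "y \<in> {0..<l} - X" for X x y
  proof -
    let ?Y = "insert y (X - {x})"
    have Y: "?Y \<in> johnson_vertices l (Suc p)" using johnson_vertices_swap X x y by blast
    have e: "insert x ?Y = insert y X" using x by auto
    have "x \<in> {0..<l} - ?Y" using x y johnson_verticesD[OF X] by auto
    then have "h ?Y \<sqsubseteq> f (insert y X)" using h(3)[OF Y, of x] unfolding e by blast
    then have "rk (h X \<squnion> h ?Y) \<le> rk (f (insert y X))"
      using h(1)[OF X] h(1)[OF Y] h(3)[OF X y] fL(1)[OF X y]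
      by (simp add: rk_mono join_least join_closed)
    then show ?thesis using rk_modular[OF h(1)[OF X] h(1)[OF Y]] h(2)[OF X] h(2)[OF Y] fL[OF X y]
      by simp
  qed
  \<comment> \<open>Each exchange on the way from X to Y costs at most one in rank, and
    \<open>rk_meet_triangle\<close> adds up these losses.\<close>
  have h_lower: "k - 1 - int (Suc p) + int (card (X \<inter> Y)) \<le> rk (h X \<sqinter> h Y)"
    if "X \<in> johnson_vertices l (Suc p)" and Y: "Y \<in> johnson_vertices l (Suc p)" for X Y
    using that
  proof (induction rule: johnson_induct)
    case base
    then show ?case using johnson_verticesD[OF Y] h[OF Y] by (simp add: meet_idem)
  next
    case (step X x y)
    let ?X = "insert y (X - {x})"
    have y: "y \<in> {0..<l} - X" using step johnson_verticesD[OF Y] by auto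
    have X': "?X \<in> johnson_vertices l (Suc p)" using johnson_vertices_swap step y by blast
    show ?case
      using rk_meet_triangle[OF h(1)[OF step(1)] h(1)[OF X'] h(1)[OF Y]] step(4) h(2)[OF X']
        h_step[of X x y] step y card_Int_swap[OF johnson_verticesD(3)[OF step(1)] step(2,3)] by simp
  qed
  have h_upper: "rk (h X \<sqinter> h Y) \<le> k - 1 - int (Suc p) + int (card (X \<inter> Y))"
    if X: "X \<in> johnson_vertices l (Suc p)" and Y: "Y \<in> johnson_vertices l (Suc p)" for X Y
  proof -
    note XD = johnson_verticesD[OF X] and YD = johnson_verticesD[OF Y]
    \<comment> \<open>Here 2(p + 2) \<le> l leaves two distinct elements outside X \<union> Y,
      because this union has at most 2(p + 1) elements. Adding a different one to each set keeps the
      intersection, and k - (p + 2) is the required (k - 1) - (p + 1).\<close>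
    have c: "card (X \<union> Y) + 2 \<le> l" using card_Un_le[of X Y] XD YD l by simp
    obtain a where a: "a \<in> {0..<l} - (X \<union> Y)" using johnson_vertices_fresh[of "X \<union> Y" l] XD YD c by auto
    obtain b where b: "b \<in> {0..<l} - insert a (X \<union> Y)"
      using johnson_vertices_fresh[of "insert a (X \<union> Y)" l] XD YD a c by auto
    have aX: "a \<in> {0..<l} - X" and bY: "b \<in> {0..<l} - Y" using a b by auto
    note L = h(1)[OF X] h(1)[OF Y] fL[OF X aX] fL[OF Y bY]
    have "h X \<sqinter> h Y \<sqsubseteq> f (insert a X)" "h X \<sqinter> h Y \<sqsubseteq> f (insert b Y)"
      using L h(3)[OF X aX] h(3)[OF Y bY] meet_le[OF L(1,2)] meet_closed[OF L(1,2)]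
        trans[of "h X \<sqinter> h Y" "h X" "f (insert a X)"] trans[of "h X \<sqinter> h Y" "h Y" "f (insert b Y)"]
      by simp_all
    then have "rk (h X \<sqinter> h Y) \<le> rk (f (insert a X) \<sqinter> f (insert b Y))"
      using L by (intro rk_mono meet_greatest meet_closed)
    moreover have "insert a X \<inter> insert b Y = X \<inter> Y" using a b by auto
    ultimately show ?thesis using isometric_rk_meet[OF iso ins[OF X aX] ins[OF Y bY]] by simp
  qed
  have iso_h: "isometric l (Suc p) (k - 1) h"
    using h(1) antisym[OF h_upper h_lower] unfolding isometric_def by simp
  \<comment> \<open>The two centres have rank k - 1 and meet in rank k - 2, so their join has the
    full rank k of the image above them.\<close>
  have f_join: "f (insert y (insert x W)) = h (insert x W) \<squnion> h (insert y W)"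
    if W: "W \<in> johnson_vertices l p" and x: "x \<in> {0..<l} - W" and y: "y \<in> {0..<l} - W"
      and ne: "x \<noteq> y" for W x y
  proof -
    have X: "insert x W \<in> johnson_vertices l (Suc p)" and Y: "insert y W \<in> johnson_vertices l (Suc p)"
      using W x y ins by auto
    have y': "y \<in> {0..<l} - insert x W" and x': "x \<in> {0..<l} - insert y W" using x y ne by auto
    let ?j = "h (insert x W) \<squnion> h (insert y W)"
    have "h (insert y W) \<sqsubseteq> f (insert y (insert x W))" using h(3)[OF Y x'] by (simp add: insert_commute)
    then have le: "?j \<sqsubseteq> f (insert y (insert x W))"
      using h(1)[OF X] h(1)[OF Y] h(3)[OF X y'] fL[OF X y'] by (intro join_least)
    have "rk ?j = k"
      using rk_modular[OF h(1)[OF X] h(1)[OF Y]] h(2)[OF X] h(2)[OF Y]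
        isometric_star_rk[OF iso_h W x y ne] by simp
    then show ?thesis using eq_if_rk[OF _ _ le] h(1)[OF X] h(1)[OF Y] fL[OF X y'] by (simp add: join_closed)
  qed
  have star_h: "star_triples_meet l p h"
    unfolding star_triples_meet_def
  proof (intro ballI impI)
    fix W x y z
    assume W: "W \<in> johnson_vertices l p" and x: "x \<in> {0..<l} - W" and y: "y \<in> {0..<l} - W"
      and z: "z \<in> {0..<l} - W" and ne: "x \<noteq> y" "x \<noteq> z" "y \<noteq> z"
    note V = ins[OF W x] ins[OF W y] ins[OF W z]
    note L = V[THEN h(1)]
    show "h (insert x W) \<sqinter> h (insert y W) \<sqsubseteq> h (insert z W)"
    proof (rule ccontr)
      \<comment> \<open>Otherwise the three centres form a top. Then the images of W + x + z and W +
        x + y are comparable, hence equal, although their vertices are adjacent.\<close>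
      assume "\<not> ?thesis"
      then have z_le: "h (insert z W) \<sqsubseteq> h (insert x W) \<squnion> h (insert y W)"
        using adjacent_triple[OF L V[THEN h(2)]] isometric_star_rk[OF iso_h W] x y z ne by simp
      have zj: "f (insert z (insert x W)) \<sqsubseteq> f (insert y (insert x W))"
        unfolding f_join[OF W x z ne(2)] f_join[OF W x y ne(1)]
        using L z_le by (intro join_least le_join join_closed)
      have y': "y \<in> {0..<l} - insert x W" and z': "z \<in> {0..<l} - insert x W" using x y z ne by auto
      then have "f (insert z (insert x W)) = f (insert y (insert x W))"
        using eq_if_rk[OF _ _ zj] fL[OF V(1)] by simp
      then have "rk (f (insert z (insert x W)) \<sqinter> f (insert y (insert x W))) = k"
        using fL[OF V(1) y'] by (simp add: meet_idem)
      then show False using isometric_star_rk[OF iso V(1) z' y'] ne by simp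
    qed
  qed
  obtain M P where MP: "M \<in> L" "rk M = k - 1 - int (Suc p)"
    "\<forall>i<l. P i \<in> L \<and> M \<sqsubseteq> P i \<and> rk (P i) = k - 1 - int p"
    "\<forall>A\<in>johnson_vertices l (Suc p). lub P A (h A)"
    using Suc.IH[OF iso_h star_h] l by auto
  have "lub P A (f A)" if A: "A \<in> johnson_vertices l (Suc (Suc p))" for A
  proof -
    note AD = johnson_verticesD[OF A]
    obtain y Y where "A = insert y Y" "y \<notin> Y" "card Y = Suc p"
      using AD(2) by (meson card_eq_SucD)
    moreover from this(3) obtain x W where "Y = insert x W" "x \<notin> W" "card W = p"
      by (meson card_eq_SucD)
    ultimately have A_eq: "A = insert y (insert x W)" "x \<notin> W" "y \<notin> insert x W" "card W = p" by simp_all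
    then have W: "W \<in> johnson_vertices l p" and x: "x \<in> {0..<l} - W" and y: "y \<in> {0..<l} - W"
      and ne: "x \<noteq> y" using AD(1) by (auto simp: johnson_vertices_def)
    have "lub P (insert x W \<union> insert y W) (h (insert x W) \<squnion> h (insert y W))"
      using MP(3,4) ins[OF W x] ins[OF W y] AD A_eq by (intro lub_join) auto
    moreover have "insert x W \<union> insert y W = A" using A_eq by auto
    ultimately show ?thesis using f_join[OF W x y ne] A_eq by simp
  qed
  then show ?case using MP by (intro exI[of _ M] exI[of _ P]) auto
qed

section \<open>The dichotomy between stars and tops\<close>

lemma star_or_costar:
  assumes iso: "isometric l (Suc (Suc p)) k f" and l: "2 * Suc (Suc p) \<le> l"
  shows "star_triples_meet l (Suc p) f \<or>
    ranked_modular_lattice.star_triples_meet (\<lambda>x y. y \<sqsubseteq> x) join l (Suc p) f \<and>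
    top_triples_meet l (Suc (Suc (Suc p))) f"
proof -
  interpret D: ranked_modular_lattice L "\<lambda>x y. y \<sqsubseteq> x" join meet "\<lambda>x. - rk x"
    by (rule dual)
  note ins = johnson_vertices_insert
  define \<sigma> where "\<sigma> X a b c \<longleftrightarrow> f (insert a X) \<sqinter> f (insert b X) \<sqsubseteq> f (insert c X)" for X a b c
  define \<tau> where "\<tau> Z a b c \<longleftrightarrow> f (Z - {a}) \<sqinter> f (Z - {b}) \<sqsubseteq> f (Z - {c})" for Z a b c
  have fL: "f A \<in> L" "rk (f A) = k" if "A \<in> johnson_vertices l (Suc (Suc p))" for A
    using isometric_closed[OF iso that] isometric_rk[OF iso that] by auto
  have meet: "rk (f (insert a X) \<sqinter> f (insert b X)) = k - 1"
    if "X \<in> johnson_vertices l (Suc p)" "a \<in> {0..<l} - X" "b \<in> {0..<l} - X" "a \<noteq> b" for X a b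
    using isometric_star_rk[OF iso that] .
  have meet_top: "rk (f (Z - {a}) \<sqinter> f (Z - {b})) = k - 1"
    if "Z \<in> johnson_vertices l (Suc (Suc (Suc p)))" "a \<in> Z" "b \<in> Z" "a \<noteq> b" for Z a b
  proof -
    have "(Z - {a}) \<inter> (Z - {b}) = Z - {a} - {b}" by auto
    then have "card ((Z - {a}) \<inter> (Z - {b})) = Suc p"
      using that johnson_verticesD[OF that(1)] by simp
    then show ?thesis
      using isometric_rk_meet[OF iso] johnson_vertices_remove[OF that(1)] that by simp
  qed
  have star_alt: "\<sigma> X a b c \<or> f (insert c X) \<sqsubseteq> f (insert a X) \<squnion> f (insert b X)"
    if X: "X \<in> johnson_vertices l (Suc p)" and "a \<in> {0..<l} - X" "b \<in> {0..<l} - X" "c \<in> {0..<l} - X"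
      "a \<noteq> b" "a \<noteq> c" "b \<noteq> c" for X a b c
    unfolding \<sigma>_def using that ins[OF X] fL meet[OF X] by (intro adjacent_triple) auto
  \<comment> \<open>The sets \<open>insert c X\<close> and \<open>?Z - {x}\<close> represent the two
    kinds of common neighbours of \<open>insert a X\<close> and \<open>insert b X\<close>. They
    intersect in X - {x}, so they are at distance 2 and their images cannot be of the same type. The
    left side does not mention \<open>x\<close> and the right side does not mention
    \<open>c\<close>; hence one triple decides for every other choice of \<open>c\<close> and
    \<open>x\<close>.\<close>
  have star_iff_not_top: "\<sigma> X a b c \<longleftrightarrow> \<not> \<tau> (insert a (insert b X)) a b x"
    if X: "X \<in> johnson_vertices l (Suc p)" and a: "a \<in> {0..<l} - X" and b: "b \<in> {0..<l} - X"
      and c: "c \<in> {0..<l} - X" and ne: "a \<noteq> b" "a \<noteq> c" "b \<noteq> c" and x: "x \<in> X" for X a b c x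
  proof -
    let ?Z = "insert a (insert b X)"
    have Z: "?Z \<in> johnson_vertices l (Suc (Suc (Suc p)))" using ins[OF ins[OF X b], of a] a ne by simp
    have e: "?Z - {a} = insert b X" "?Z - {b} = insert a X" using a b ne by auto
    note V = ins[OF X a] ins[OF X b] ins[OF X c] johnson_vertices_remove[OF Z, of x]
    have "insert c X \<inter> (?Z - {x}) = X - {x}" using a b c ne x by auto
    then have far: "rk (f (insert c X) \<sqinter> f (?Z - {x})) = k - 2"
      using isometric_rk_meet[OF iso V(3,4)] johnson_verticesD[OF X] x by simp
    have ne': "a \<noteq> x" "b \<noteq> x" using a b x by auto
    have comm: "f (insert b X) \<sqinter> f (insert a X) = f (insert a X) \<sqinter> f (insert b X)"
      using meet_comm V fL by blast
    have "\<tau> ?Z a b x \<or> f (?Z - {x}) \<sqsubseteq> f (insert a X) \<squnion> f (insert b X)"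
      unfolding \<tau>_def e comm
      using adjacent_triple[of "f (insert a X)" "f (insert b X)" "f (?Z - {x})" k]
        V fL meet[OF X a b] ne ne' meet_top[OF Z, of a x] meet_top[OF Z, of b x] x unfolding e by simp
    moreover have "\<not> (\<sigma> X a b c \<and> \<tau> ?Z a b x)"
      unfolding \<sigma>_def \<tau>_def e comm
      using not_both_above_meet[of "f (insert a X)" "f (insert b X)" "f (insert c X)" "f (?Z - {x})"]
        V fL far meet[OF X a b] ne x by simp
    moreover have "\<not> (f (insert c X) \<sqsubseteq> f (insert a X) \<squnion> f (insert b X) \<and>
        f (?Z - {x}) \<sqsubseteq> f (insert a X) \<squnion> f (insert b X))"
      using not_both_below_join[of "f (insert a X)" "f (insert b X)" "f (insert c X)" "f (?Z - {x})"]
        V fL far meet[OF X a b] ne x by simp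
    ultimately show ?thesis using star_alt[OF X a b c ne] by blast
  qed
  define S where "S X \<longleftrightarrow> (\<forall>a\<in>{0..<l} - X. \<forall>b\<in>{0..<l} - X. \<forall>c\<in>{0..<l} - X.
     a \<noteq> b \<longrightarrow> a \<noteq> c \<longrightarrow> b \<noteq> c \<longrightarrow> \<sigma> X a b c)" for X
  \<comment> \<open>With \<open>a\<close> and \<open>b\<close> fixed, the truth of \<sigma> does not
    depend on the third element, so \<open>?y\<close> lies below all images over X. Equality of
    ranks then makes every pairwise meet equal to \<open>?y\<close>.\<close>
  have S_I: "S X"
    if X: "X \<in> johnson_vertices l (Suc p)" and a: "a \<in> {0..<l} - X" and b: "b \<in> {0..<l} - X"
      and c: "c \<in> {0..<l} - X" and ne: "a \<noteq> b" "a \<noteq> c" "b \<noteq> c" and \<sigma>: "\<sigma> X a b c" for X a b c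
  proof -
    let ?y = "f (insert a X) \<sqinter> f (insert b X)"
    note FL = fL[OF ins[OF X]]
    obtain x where x: "x \<in> X" using johnson_verticesD[OF X] by fastforce
    have le: "?y \<sqsubseteq> f (insert d X)" if d: "d \<in> {0..<l} - X" for d
    proof (cases "d = a \<or> d = b")
      case True
      then show ?thesis using meet_le FL a b by blast
    next
      case False
      then show ?thesis using star_iff_not_top[OF X a b _ ne(1) _ _ x] c d ne \<sigma> unfolding \<sigma>_def by metis
    qed
    show ?thesis unfolding S_def \<sigma>_def
    proof (intro ballI impI)
      fix a' b' c' assume d: "a' \<in> {0..<l} - X" "b' \<in> {0..<l} - X" "c' \<in> {0..<l} - X" "a' \<noteq> b'"
      have "?y \<sqsubseteq> f (insert a' X) \<sqinter> f (insert b' X)"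
        using le d a b FL by (intro meet_greatest meet_closed) auto
      then have "?y = f (insert a' X) \<sqinter> f (insert b' X)"
        using a b d FL meet[OF X] ne by (intro eq_if_rk meet_closed) auto
      then show "f (insert a' X) \<sqinter> f (insert b' X) \<sqsubseteq> f (insert c' X)" using le d by metis
    qed
  qed
  have S_step: "S X"
    if X: "X \<in> johnson_vertices l (Suc p)" and x: "x \<in> X" and y: "y \<in> {0..<l} - X"
      and SX: "S (insert y (X - {x}))" for X x y
  proof -
    let ?X = "insert y (X - {x})"
    note XD = johnson_verticesD[OF X]
    have X': "?X \<in> johnson_vertices l (Suc p)" using johnson_vertices_swap X x y by blast
    \<comment> \<open>Two elements outside X + y exist: with m = p + 2 the set X has m - 1 elements,
      and m + 2 \<le> 2m \<le> l.\<close>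
    obtain b where "b \<in> {0..<l} - insert y X"
      using johnson_vertices_fresh[of "insert y X" l] XD y l by auto
    then have b: "b \<in> {0..<l} - X" "b \<noteq> y" by auto
    obtain c where "c \<in> {0..<l} - insert b (insert y X)"
      using johnson_vertices_fresh[of "insert b (insert y X)" l] XD y b l by auto
    then have c: "c \<in> {0..<l} - X" "c \<noteq> y" "c \<noteq> b" by auto
    have xl: "x \<in> {0..<l} - ?X" and b': "b \<in> {0..<l} - ?X" and c': "c \<in> {0..<l} - ?X"
      and ne: "x \<noteq> b" "x \<noteq> c" "y \<noteq> b" "x \<noteq> y" using x y b c XD by auto
    \<comment> \<open>The set \<open>?Z\<close> arises from X by adding y, b and from
      \<open>?X\<close> by adding x, b. So the same clique below \<open>?Z\<close> is compared with
      the stars of both sets, and symmetry of star triples carries the failure of \<tau>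
      across.\<close>
    let ?Z = "insert y (insert b X)"
    have eZ: "insert x (insert b ?X) = ?Z" using x by auto
    have Z: "?Z \<in> johnson_vertices l (Suc (Suc (Suc p)))" using ins[OF ins[OF X b(1)], of y] y b by simp
    have VZ: "f (?Z - {i}) \<in> L" if "i \<in> ?Z" for i using fL johnson_vertices_remove[OF Z that] by blast
    have "\<sigma> ?X x b c" using SX xl b' c' ne c unfolding S_def by metis
    then have "\<not> \<tau> ?Z x b y"
      using star_iff_not_top[OF X' xl b' c', of y] ne c unfolding eZ by auto
    then have "\<not> \<tau> ?Z y b x"
    proof -
      let ?a = "f (?Z - {b})" and ?b = "f (?Z - {y})" and ?c = "f (?Z - {x})"
      have L: "?a \<in> L" "?b \<in> L" "?c \<in> L" using VZ x by blast+
      have "rk (?a \<sqinter> ?b) = rk (?a \<sqinter> ?c)"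
        using meet_top[OF Z, of b y] meet_top[OF Z, of b x] ne x by simp
      then have "?a \<sqinter> ?b \<sqsubseteq> ?c \<Longrightarrow> ?a \<sqinter> ?c \<sqsubseteq> ?b" using adjacent_triple_rotate[OF L] by blast
      then show "\<not> \<tau> ?Z x b y \<Longrightarrow> \<not> \<tau> ?Z y b x"
        unfolding \<tau>_def meet_comm[OF L(2,1)] meet_comm[OF L(3,1)] by blast
    qed
    then have "\<sigma> X y b c" using star_iff_not_top[OF X y b(1) c(1) _ _ _ x] ne c by auto
    then show ?thesis using S_I[OF X y b(1) c(1)] ne c by auto
  qed
  show ?thesis
  proof (cases "\<exists>X\<in>johnson_vertices l (Suc p). \<exists>a\<in>{0..<l} - X. \<exists>b\<in>{0..<l} - X. \<exists>c\<in>{0..<l} - X.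
      a \<noteq> b \<and> a \<noteq> c \<and> b \<noteq> c \<and> \<sigma> X a b c")
    case True
    then obtain Y where Y: "Y \<in> johnson_vertices l (Suc p)" "S Y" using S_I by blast
    have "S X" if "X \<in> johnson_vertices l (Suc p)" for X
      using that Y(1)
    proof (induction rule: johnson_induct)
      case base
      then show ?case using Y by simp
    next
      case (step X x y)
      then show ?case using S_step[of X x y] johnson_verticesD[OF Y(1)] by auto
    qed
    then show ?thesis unfolding S_def \<sigma>_def star_triples_meet_def by blast
  next
    case False
    then have no: "\<not> \<sigma> X a b c" if "X \<in> johnson_vertices l (Suc p)" "a \<in> {0..<l} - X" "b \<in> {0..<l} - X"
      "c \<in> {0..<l} - X" "a \<noteq> b" "a \<noteq> c" "b \<noteq> c" for X a b c using that by blast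
    \<comment> \<open>In the opposite order the join takes the place of the meet, so this is the
      alternative left by \<open>star_alt\<close>.\<close>
    have "D.star_triples_meet l (Suc p) f"
      unfolding D.star_triples_meet_def using no star_alt by blast
    moreover have "\<tau> Z a b x" if Z: "Z \<in> johnson_vertices l (Suc (Suc (Suc p)))"
      and mem: "a \<in> Z" "b \<in> Z" "x \<in> Z" and ne: "a \<noteq> b" "a \<noteq> x" "b \<noteq> x" for Z a b x
    proof -
      note ZD = johnson_verticesD[OF Z]
      let ?X = "Z - {a} - {b}"
      have X: "?X \<in> johnson_vertices l (Suc p)"
        using johnson_vertices_remove[OF johnson_vertices_remove[OF Z]] mem ne by simp
      \<comment> \<open>A fourth element is needed only to apply the equivalence; it exists because
        |Z| = p + 3 < 2(p + 2) \<le> l.\<close>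
      obtain c where c: "c \<in> {0..<l} - Z" using johnson_vertices_fresh[of Z l] ZD l by auto
      have e: "insert a (insert b ?X) = Z" using mem by auto
      have V: "a \<in> {0..<l} - ?X" "b \<in> {0..<l} - ?X" "c \<in> {0..<l} - ?X" "a \<noteq> c" "b \<noteq> c" "x \<in> ?X"
        using ZD(1) mem ne c by auto
      then show ?thesis
        using star_iff_not_top[OF X V(1-3) ne(1) V(4-6)] no[OF X V(1-3) ne(1) V(4,5)] unfolding e by blast
    qed
    then have "top_triples_meet l (Suc (Suc (Suc p))) f"
      unfolding top_triples_meet_def \<tau>_def by blast
    ultimately show ?thesis by blast
  qed
qed

section \<open>Duality, complementation and the span of 2m points\<close>

lemma isometric_dual:
  assumes "isometric l m k f"
  shows "ranked_modular_lattice.isometric L join (\<lambda>x. - rk x) l m (- k) f"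
proof -
  interpret D: ranked_modular_lattice L "\<lambda>x y. y \<sqsubseteq> x" join meet "\<lambda>x. - rk x"
    by (rule dual)
  show ?thesis
    unfolding D.isometric_def
  proof (intro conjI ballI)
    fix A B assume AB: "A \<in> johnson_vertices l m" "B \<in> johnson_vertices l m"
    \<comment> \<open>By modularity the join has rank k + m - |A \<inter> B|; negation gives the
      same formula with - k in place of k.\<close>
    show "- rk (f A \<squnion> f B) = - k - int m + int (card (A \<inter> B))"
      using rk_modular[of "f A" "f B"] isometric_closed[OF assms] isometric_rk[OF assms]
        isometric_rk_meet[OF assms] AB by simp
  qed (use isometric_closed[OF assms] in blast)
qed

text \<open>Passing to complements exchanges the roles of A - B and B - A, so distances are
  preserved.\<close>

lemma isometric_complement:
  assumes "isometric l m k f" "m \<le> l"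
  shows "isometric l (l - m) k (\<lambda>A. f ({0..<l} - A))"
proof -
  have V: "{0..<l} - A \<in> johnson_vertices l m" if "A \<in> johnson_vertices l (l - m)" for A
    using johnson_verticesD[OF that] assms(2) by (intro johnson_verticesI) (auto simp: card_Diff_subset)
  have "rk (f ({0..<l} - A) \<sqinter> f ({0..<l} - B)) = k - int (l - m) + int (card (A \<inter> B))"
    if A: "A \<in> johnson_vertices l (l - m)" and B: "B \<in> johnson_vertices l (l - m)" for A B
  proof -
    note AD = johnson_verticesD[OF A] and BD = johnson_verticesD[OF B]
    have "({0..<l} - A) \<inter> ({0..<l} - B) = {0..<l} - (A \<union> B)" by auto
    moreover have "card ({0..<l} - (A \<union> B)) = l - card (A \<union> B)"
      using AD BD by (subst card_Diff_subset) auto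
    moreover have "card (A \<union> B) \<le> l" using AD BD card_mono[of "{0..<l}" "A \<union> B"] by simp
    moreover have "card (A \<union> B) + card (A \<inter> B) = 2 * (l - m)"
      using card_Un_Int[OF AD(3) BD(3)] AD BD by simp
    ultimately show ?thesis
      using isometric_rk_meet[OF assms(1) V[OF A] V[OF B]] assms(2) by simp
  qed
  then show ?thesis using isometric_closed[OF assms(1) V] unfolding isometric_def by blast
qed

text \<open>Splitting \<open>T\<close> into two disjoint vertices presents its least upper bound as
  the join of two images that meet in rank k - m; modularity gives 2k - (k - m).\<close>

lemma isometric_lub_rk:
  assumes iso: "isometric l m k f" and P: "P ` {0..<l} \<subseteq> L"
    and lub: "\<And>A. A \<in> johnson_vertices l m \<Longrightarrow> lub P A (f A)"
    and T: "T \<subseteq> {0..<l}" "card T = 2 * m"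
  shows "\<exists>u. lub P T u \<and> rk u = k + int m"
proof -
  obtain A where A: "A \<subseteq> T" "card A = m"
    using T obtain_subset_with_card_n[of m T] by auto
  have fin: "finite T" using T finite_subset by blast
  have V: "A \<in> johnson_vertices l m" "T - A \<in> johnson_vertices l m"
    using A T fin by (auto simp: johnson_vertices_def card_Diff_subset finite_subset)
  have "lub P (A \<union> (T - A)) (f A \<squnion> f (T - A))"
    using A T P lub V by (intro lub_join) auto
  moreover have "A \<union> (T - A) = T" using A by auto
  moreover have "rk (f A \<sqinter> f (T - A)) = k - int m"
    using isometric_rk_meet[OF iso V] by simp
  ultimately show ?thesis
    using rk_modular[of "f A" "f (T - A)"] isometric_closed[OF iso] isometric_rk[OF iso] V
    by (intro exI[of _ "f A \<squnion> f (T - A)"]) auto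
qed

text \<open>The points are later counted as a set, so they must be distinct. If
  \<open>P i = P j\<close>, two vertices that differ only in i and j would have equal
  images.\<close>

lemma isometric_lub_inj:
  assumes iso: "isometric l (Suc p) k f" and l: "Suc p < l"
    and lub: "\<And>A. A \<in> johnson_vertices l (Suc p) \<Longrightarrow> lub P A (f A)"
  shows "inj_on P {0..<l}"
proof (rule inj_onI, rule ccontr)
  fix i j assume ij: "i \<in> {0..<l}" "j \<in> {0..<l}" "P i = P j" "i \<noteq> j"
  have "p \<le> card ({0..<l} - {i, j})" using ij l by (simp add: card_Diff_subset)
  then obtain X where "X \<subseteq> {0..<l} - {i, j}" "card X = p"
    by (meson obtain_subset_with_card_n)
  then have X: "X \<in> johnson_vertices l p" and i: "i \<in> {0..<l} - X" and j: "j \<in> {0..<l} - X"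
    using ij by (auto simp: johnson_vertices_def)
  note V = johnson_vertices_insert[OF X i] johnson_vertices_insert[OF X j]
  have "f (insert i X) \<sqsubseteq> f (insert j X)"
    using lub[OF V(1)] lub[OF V(2)] ij unfolding lub_def by auto
  then have "f (insert i X) = f (insert j X)"
    using isometric_closed[OF iso] isometric_rk[OF iso] V by (intro eq_if_rk) auto
  then have "rk (f (insert i X) \<sqinter> f (insert j X)) = k"
    using isometric_closed[OF iso V(1)] isometric_rk[OF iso V(1)] by (simp add: meet_idem)
  then show False using isometric_star_rk[OF iso X i j ij(4)] by simp
qed

end

section \<open>Subspaces over a division ring\<close>

locale left_space =
  fixes sc :: "'r::division_ring \<Rightarrow> 'v::ab_group_add \<Rightarrow> 'v"
  assumes left_vector_space: "left_vector_space sc"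
begin

lemma scale_add: "sc a (x + y) = sc a x + sc a y"
  and scale_add_left: "sc (a + b) x = sc a x + sc b x"
  and scale_scale: "sc a (sc b x) = sc (a * b) x"
  and scale_one: "sc 1 x = x"
  using left_vector_space unfolding left_vector_space_def by blast+

lemma scale_zero: "sc a 0 = 0" "sc 0 x = 0"
  using scale_add[of a 0 0] scale_add_left[of 0 0 x] by simp_all

lemma scale_minus: "sc (- a) x = - sc a x"
  using scale_add_left[of a "- a" x] by (simp add: scale_zero minus_unique)

lemma scale_sum: "sc a (\<Sum>v\<in>T. g v) = (\<Sum>v\<in>T. sc a (g v))"
  by (induction T rule: infinite_finite_induct) (simp_all add: scale_zero scale_add)

lemma subspace_0: "lvs_subspace sc W \<Longrightarrow> 0 \<in> W"
  and subspace_add: "lvs_subspace sc W \<Longrightarrow> x \<in> W \<Longrightarrow> y \<in> W \<Longrightarrow> x + y \<in> W"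
  and subspace_scale: "lvs_subspace sc W \<Longrightarrow> x \<in> W \<Longrightarrow> sc a x \<in> W"
  by (auto simp: lvs_subspace_def)

lemma subspace_minus: "lvs_subspace sc W \<Longrightarrow> x \<in> W \<Longrightarrow> - x \<in> W"
  using subspace_scale[of W x "- 1"] by (simp add: scale_minus scale_one)

lemma subspace_diff: "lvs_subspace sc W \<Longrightarrow> x \<in> W \<Longrightarrow> y \<in> W \<Longrightarrow> x - y \<in> W"
  using subspace_add[of W x "- y"] subspace_minus by simp

lemma subspace_sum: "lvs_subspace sc W \<Longrightarrow> (\<And>v. v \<in> T \<Longrightarrow> g v \<in> W) \<Longrightarrow> (\<Sum>v\<in>T. g v) \<in> W"
  by (induction T rule: infinite_finite_induct) (simp_all add: subspace_0 subspace_add)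

lemma subspace_Int: "lvs_subspace sc U \<Longrightarrow> lvs_subspace sc W \<Longrightarrow> lvs_subspace sc (U \<inter> W)"
  by (simp add: lvs_subspace_def)

lemma subspace_Inter: "(\<And>W. W \<in> F \<Longrightarrow> lvs_subspace sc W) \<Longrightarrow> lvs_subspace sc (\<Inter>F)"
  by (simp add: lvs_subspace_def)

lemma subspace_UNIV: "lvs_subspace sc UNIV"
  by (simp add: lvs_subspace_def)

lemma span_superset: "S \<subseteq> lvs_span sc S"
proof
  fix x assume "x \<in> S"
  then show "x \<in> lvs_span sc S"
    unfolding lvs_span_def
    by (intro CollectI exI[of _ "{x}"] exI[of _ "\<lambda>_. 1"]) (simp add: scale_one)
qed

lemma span_least:
  assumes "lvs_subspace sc W" "S \<subseteq> W"
  shows "lvs_span sc S \<subseteq> W"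
  unfolding lvs_span_def using assms by (auto intro!: subspace_sum subspace_scale)

lemma subspace_span: "lvs_subspace sc (lvs_span sc S)"
  unfolding lvs_subspace_def
proof (intro conjI ballI allI)
  show "0 \<in> lvs_span sc S"
    unfolding lvs_span_def by (intro CollectI exI[of _ "{}"]) simp
next
  fix x y assume "x \<in> lvs_span sc S" "y \<in> lvs_span sc S"
  then obtain T U c d where T: "finite T" "T \<subseteq> S" "x = (\<Sum>v\<in>T. sc (c v) v)"
    and U: "finite U" "U \<subseteq> S" "y = (\<Sum>v\<in>U. sc (d v) v)"
    unfolding lvs_span_def by blast
  let ?c = "\<lambda>v. if v \<in> T then c v else 0" and ?d = "\<lambda>v. if v \<in> U then d v else 0"
  have "x = (\<Sum>v\<in>T \<union> U. sc (?c v) v)"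
    unfolding T(3) using T U by (intro sum.mono_neutral_cong_left) (auto simp: scale_zero)
  moreover have "y = (\<Sum>v\<in>T \<union> U. sc (?d v) v)"
    unfolding U(3) using T U by (intro sum.mono_neutral_cong_left) (auto simp: scale_zero)
  ultimately have "x + y = (\<Sum>v\<in>T \<union> U. sc (?c v + ?d v) v)"
    by (simp only: scale_add_left sum.distrib)
  then show "x + y \<in> lvs_span sc S"
    unfolding lvs_span_def using T U
    by (intro CollectI exI[of _ "T \<union> U"] exI[of _ "\<lambda>v. ?c v + ?d v"]) simp
next
  fix a x assume "x \<in> lvs_span sc S"
  then obtain T c where T: "finite T" "T \<subseteq> S" "x = (\<Sum>v\<in>T. sc (c v) v)"
    unfolding lvs_span_def by blast
  then have "sc a x = (\<Sum>v\<in>T. sc (a * c v) v)" by (simp add: scale_sum scale_scale)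
  then show "sc a x \<in> lvs_span sc S"
    unfolding lvs_span_def using T(1,2)
    by (intro CollectI exI[of _ T] exI[of _ "\<lambda>v. a * c v"]) simp
qed

lemma span_mono: "S \<subseteq> T \<Longrightarrow> lvs_span sc S \<subseteq> lvs_span sc T"
  by (meson span_least span_superset subspace_span subset_trans)

lemma span_subset_iff: "lvs_span sc S \<subseteq> lvs_span sc T \<longleftrightarrow> S \<subseteq> lvs_span sc T"
  by (meson span_least span_superset subspace_span subset_trans)

lemma span_subspace: "lvs_subspace sc W \<Longrightarrow> lvs_span sc W = W"
  by (simp add: span_least span_superset subset_antisym)

text \<open>The vectors described on the right form a subspace containing \<open>a\<close> and
  \<open>S\<close>, hence everything that these span.\<close>

lemma span_insert_iff: "x \<in> lvs_span sc (insert a S) \<longleftrightarrow> (\<exists>k. x - sc k a \<in> lvs_span sc S)"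
proof
  let ?W = "{x. \<exists>k. x - sc k a \<in> lvs_span sc S}"
  have "lvs_subspace sc ?W"
    unfolding lvs_subspace_def
  proof (intro conjI ballI allI)
    show "0 \<in> ?W" using subspace_0[OF subspace_span] by (auto intro: exI[of _ 0] simp: scale_zero)
  next
    fix x y assume "x \<in> ?W" "y \<in> ?W"
    then obtain i j where "x - sc i a \<in> lvs_span sc S" "y - sc j a \<in> lvs_span sc S" by blast
    then have "(x - sc i a) + (y - sc j a) \<in> lvs_span sc S" by (rule subspace_add[OF subspace_span])
    then have "(x + y) - sc (i + j) a \<in> lvs_span sc S" by (simp add: scale_add_left algebra_simps)
    then show "x + y \<in> ?W" by blast
  next
    fix b x assume "x \<in> ?W"
    then obtain i where "x - sc i a \<in> lvs_span sc S" by blast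
    then have "sc b (x - sc i a) \<in> lvs_span sc S" by (rule subspace_scale[OF subspace_span])
    moreover have "sc b (x - sc i a) = sc b x - sc (b * i) a"
      using scale_add[of b "x - sc i a" "sc i a"] by (simp add: scale_scale algebra_simps)
    ultimately show "sc b x \<in> ?W" by auto
  qed
  moreover have "a \<in> ?W" using subspace_0[OF subspace_span] by (auto intro!: exI[of _ 1] simp: scale_one)
  moreover have "S \<subseteq> ?W" using span_superset[of S] by (auto intro!: exI[of _ 0] simp: scale_zero)
  ultimately have "lvs_span sc (insert a S) \<subseteq> ?W" by (intro span_least) auto
  then show "x \<in> lvs_span sc (insert a S) \<Longrightarrow> \<exists>k. x - sc k a \<in> lvs_span sc S" by blast
next
  assume "\<exists>k. x - sc k a \<in> lvs_span sc S"
  then obtain k where k: "x - sc k a \<in> lvs_span sc (insert a S)"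
    using span_mono[of S "insert a S"] by blast
  have "sc k a \<in> lvs_span sc (insert a S)"
    using span_superset by (intro subspace_scale[OF subspace_span]) blast
  from subspace_add[OF subspace_span k this] show "x \<in> lvs_span sc (insert a S)" by simp
qed

section \<open>Exchange, bases and dimension\<close>

lemma span_exchange:
  assumes "y \<in> lvs_span sc (insert x S)" "y \<notin> lvs_span sc S"
  shows "x \<in> lvs_span sc (insert y S)"
proof -
  obtain k where k: "y - sc k x \<in> lvs_span sc S" using assms span_insert_iff by blast
  have "k \<noteq> 0" using k assms(2) by (auto simp: scale_zero)
  then have "sc (inverse k) (sc k x) = x" by (simp add: scale_scale scale_one)
  moreover have "sc k x \<in> lvs_span sc (insert y S)"
  proof -
    have "y \<in> lvs_span sc (insert y S)" using span_superset by blast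
    moreover have "y - sc k x \<in> lvs_span sc (insert y S)" using k span_mono[of S "insert y S"] by blast
    ultimately have "y - (y - sc k x) \<in> lvs_span sc (insert y S)" by (rule subspace_diff[OF subspace_span])
    then show ?thesis by simp
  qed
  ultimately show ?thesis using subspace_scale[OF subspace_span, of "sc k x" _ "inverse k"] by simp
qed

lemma indep_iff: "lvs_indep sc S \<longleftrightarrow> (\<forall>v\<in>S. v \<notin> lvs_span sc (S - {v}))"
proof (intro iffI ballI notI)
  fix v assume ind: "lvs_indep sc S" and v: "v \<in> S" "v \<in> lvs_span sc (S - {v})"
  then obtain T c where T: "finite T" "T \<subseteq> S - {v}" "v = (\<Sum>u\<in>T. sc (c u) u)"
    unfolding lvs_span_def by blast
  let ?c = "c(v := - 1)"
  have "v \<notin> T" using T by blast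
  then have "(\<Sum>u\<in>T. sc (?c u) u) = (\<Sum>u\<in>T. sc (c u) u)" by (intro sum.cong) auto
  then have "(\<Sum>u\<in>insert v T. sc (?c u) u) = 0"
    using T(1,3) \<open>v \<notin> T\<close> by (simp add: scale_minus scale_one)
  moreover have "finite (insert v T)" "insert v T \<subseteq> S" using T v by blast+
  ultimately have "\<forall>u\<in>insert v T. ?c u = 0"
    using ind[unfolded lvs_indep_def, THEN spec, THEN spec, of "insert v T" ?c] by blast
  then show False by simp
next
  assume *: "\<forall>v\<in>S. v \<notin> lvs_span sc (S - {v})"
  show "lvs_indep sc S"
    unfolding lvs_indep_def
  proof (intro allI impI ballI, rule ccontr)
    fix T c v assume T: "finite T \<and> T \<subseteq> S \<and> (\<Sum>v\<in>T. sc (c v) v) = 0" and v: "v \<in> T" "c v \<noteq> 0"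
    have "sc (c v) v + (\<Sum>u\<in>T - {v}. sc (c u) u) = 0"
      using T v(1) sum.remove[of T v "\<lambda>u. sc (c u) u"] by simp
    then have e: "sc (c v) v = - (\<Sum>u\<in>T - {v}. sc (c u) u)" by (simp add: eq_neg_iff_add_eq_0)
    have "(\<Sum>u\<in>T - {v}. sc (c u) u) \<in> lvs_span sc (S - {v})"
      using T unfolding lvs_span_def by (intro CollectI exI[of _ "T - {v}"] exI[of _ c]) auto
    then have "sc (inverse (c v)) (sc (c v) v) \<in> lvs_span sc (S - {v})"
      unfolding e by (intro subspace_scale[OF subspace_span] subspace_minus[OF subspace_span])
    then have "v \<in> lvs_span sc (S - {v})" using v by (simp add: scale_scale scale_one)
    then show False using * T v by blast
  qed
qed

lemma indep_empty: "lvs_indep sc {}"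
  by (simp add: indep_iff)

lemma indep_mono:
  assumes "lvs_indep sc S" "T \<subseteq> S"
  shows "lvs_indep sc T"
  using assms unfolding lvs_indep_def by blast

lemma indep_insert:
  assumes "lvs_indep sc S" "x \<notin> lvs_span sc S"
  shows "lvs_indep sc (insert x S)"
  unfolding indep_iff
proof (intro ballI notI)
  fix v assume v: "v \<in> insert x S" "v \<in> lvs_span sc (insert x S - {v})"
  have "x \<notin> S" using assms span_superset by blast
  show False
  proof (cases "v = x")
    case True
    then show ?thesis using v assms \<open>x \<notin> S\<close> by simp
  next
    case False
    then have "v \<in> lvs_span sc (insert x (S - {v}))" "v \<in> S" using v by (auto simp: insert_Diff_if)
    moreover have "v \<notin> lvs_span sc (S - {v})" using assms \<open>v \<in> S\<close> indep_iff by blast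
    ultimately have "x \<in> lvs_span sc (insert v (S - {v}))" using span_exchange by blast
    then show ?thesis using assms \<open>v \<in> S\<close> by (simp add: insert_absorb)
  qed
qed

text \<open>Inside an independent set, a subset can be recovered from its span. This serves the
  replacement argument and, later, the identification of the members of an apartment.\<close>

lemma indep_span_mem:
  assumes "lvs_indep sc S" "T \<subseteq> S" "x \<in> S" "x \<in> lvs_span sc T"
  shows "x \<in> T"
proof (rule ccontr)
  assume "x \<notin> T"
  then have "T \<subseteq> S - {x}" using assms(2) by blast
  then show False using assms span_mono indep_iff by blast
qed

text \<open>When the elements of \<open>H\<close> are added to \<open>A\<close> one by one, some
  element first brings \<open>e\<close> into the span, and that one can be exchanged for
  \<open>e\<close>. Keeping \<open>A\<close> apart protects its elements from being
  exchanged.\<close>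

lemma span_exchange_finite:
  assumes "finite H" "e \<in> lvs_span sc (A \<union> H)" "e \<notin> lvs_span sc A"
  shows "\<exists>g\<in>H. g \<in> lvs_span sc (insert e (A \<union> (H - {g})))"
  using assms
proof (induction H)
  case empty
  then show ?case by simp
next
  case (insert h H)
  show ?case
  proof (cases "e \<in> lvs_span sc (A \<union> H)")
    case True
    then obtain g where "g \<in> H" "g \<in> lvs_span sc (insert e (A \<union> (H - {g})))" using insert by blast
    moreover have "lvs_span sc (insert e (A \<union> (H - {g}))) \<subseteq> lvs_span sc (insert e (A \<union> (insert h H - {g})))"
      by (intro span_mono) blast
    ultimately show ?thesis by blast
  next
    case False
    then have "h \<in> lvs_span sc (insert e (A \<union> H))" using insert span_exchange by simp
    moreover have "insert h H - {h} = H" using insert by simp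
    ultimately show ?thesis by simp
  qed
qed

text \<open>Steinitz replacement: a vector of G - I is replaced by one of I - G without losing the
  span or changing the size of \<open>G\<close>. Protecting I \<inter> G makes I - G shrink, until I
  \<subseteq> G.\<close>

lemma indep_card_le:
  assumes "finite G" "finite I" "lvs_indep sc I" "I \<subseteq> lvs_span sc G"
  shows "card I \<le> card G"
  using assms
proof (induction "card (I - G)" arbitrary: G)
  case 0
  then have "I \<subseteq> G" by simp
  then show ?case using 0 card_mono by blast
next
  case (Suc d)
  have "I - G \<noteq> {}" using Suc.hyps(2) by (metis card.empty nat.distinct(1))
  then obtain e where e: "e \<in> I" "e \<notin> G" by blast
  have "I \<inter> G \<union> (G - I) = G" by auto
  then have "e \<in> lvs_span sc (I \<inter> G \<union> (G - I))" using e Suc.prems(4) by auto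
  moreover have "e \<notin> lvs_span sc (I \<inter> G)" using indep_span_mem[OF Suc(5), of "I \<inter> G" e] e by auto
  ultimately obtain g where g: "g \<in> G - I" "g \<in> lvs_span sc (insert e (I \<inter> G \<union> (G - I - {g})))"
    using span_exchange_finite[of "G - I" e "I \<inter> G"] Suc.prems(1) by auto
  let ?G = "insert e (G - {g})"
  have "I \<inter> G \<union> (G - I - {g}) = G - {g}" using g by auto
  then have "G \<subseteq> lvs_span sc ?G" using g span_superset[of ?G] by auto
  then have sub: "I \<subseteq> lvs_span sc ?G" using Suc(6) span_subset_iff[of G ?G] by simp
  have "I - ?G = (I - G) - {e}" using g by auto
  then have "d = card (I - ?G)" using Suc.hyps(2) Suc.prems(2) e by simp
  from Suc.hyps(1)[OF this _ Suc.prems(2,3) sub] have "card I \<le> card ?G" using Suc.prems(1) by simp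
  also have "card ?G = card G" using Suc.prems(1) g e card_gt_0_iff[of G] by auto
  finally show ?case .
qed

lemma has_dim_unique:
  assumes "lvs_has_dim sc W d" "lvs_has_dim sc W e"
  shows "d = e"
proof -
  obtain B C where "finite B" "lvs_indep sc B" "lvs_span sc B = W" "B \<subseteq> W" "card B = d"
    "finite C" "lvs_indep sc C" "lvs_span sc C = W" "C \<subseteq> W" "card C = e"
    using assms unfolding lvs_has_dim_def lvs_basis_def by blast
  then show ?thesis using indep_card_le[of B C] indep_card_le[of C B] by simp
qed

lemma dim_eq:
  assumes "lvs_has_dim sc W d"
  shows "lvs_dim sc W = d"
  unfolding lvs_dim_def
proof (rule Least_equality[of _ d])
  show "d \<le> e" if "lvs_has_dim sc W e" for e using has_dim_unique[OF assms that] by simp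
qed (rule assms)

lemma has_dim_span: "lvs_indep sc S \<Longrightarrow> finite S \<Longrightarrow> lvs_has_dim sc (lvs_span sc S) (card S)"
  unfolding lvs_has_dim_def lvs_basis_def using span_superset by blast

end

locale finite_left_space = left_space +
  fixes n :: nat
  assumes dim_UNIV: "lvs_has_dim sc UNIV n"
begin

lemma indep_card_le_dim: "lvs_indep sc I \<Longrightarrow> finite I \<Longrightarrow> card I \<le> n"
  using dim_UNIV indep_card_le unfolding lvs_has_dim_def lvs_basis_def by auto

lemma basis_extend:
  assumes "lvs_subspace sc W" "lvs_indep sc S" "finite S" "S \<subseteq> W"
  shows "\<exists>B. S \<subseteq> B \<and> finite B \<and> lvs_basis sc W B"
  using assms
proof (induction "n - card S" arbitrary: S rule: less_induct)
  case less
  show ?case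
  proof (cases "lvs_span sc S = W")
    case True
    then show ?thesis using less unfolding lvs_basis_def by blast
  next
    case False
    then obtain x where x: "x \<in> W" "x \<notin> lvs_span sc S" using span_least less by blast
    have ind: "lvs_indep sc (insert x S)" using indep_insert less x by blast
    have "x \<notin> S" using x span_superset[of S] by blast
    then have "card (insert x S) = Suc (card S)" using less.prems(3) by simp
    then have "n - card (insert x S) < n - card S"
      using indep_card_le_dim[OF ind] less.prems(3) by simp
    from less.hyps[OF this less.prems(1) ind]
    have "\<exists>B. insert x S \<subseteq> B \<and> finite B \<and> lvs_basis sc W B"
      using less.prems(3,4) x by simp
    then show ?thesis by blast
  qed
qed

lemma has_dim_dim:
  assumes "lvs_subspace sc W"
  shows "lvs_has_dim sc W (lvs_dim sc W)"
proof -
  obtain B where "finite B" "lvs_basis sc W B" using basis_extend[OF assms indep_empty] by auto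
  then have "lvs_has_dim sc W (card B)" unfolding lvs_has_dim_def by blast
  then show ?thesis using dim_eq by simp
qed

lemma obtain_basis:
  assumes "lvs_subspace sc W"
  obtains B where "finite B" "lvs_indep sc B" "lvs_span sc B = W" "card B = lvs_dim sc W"
  using has_dim_dim[OF assms] unfolding lvs_has_dim_def lvs_basis_def by blast

lemma dim_mono:
  assumes U: "lvs_subspace sc U" and W: "lvs_subspace sc W" and "U \<subseteq> W"
  shows "lvs_dim sc U \<le> lvs_dim sc W"
proof -
  obtain B where "finite B" "lvs_indep sc B" "lvs_span sc B = U" "card B = lvs_dim sc U"
    using obtain_basis[OF U] .
  moreover obtain C where "finite C" "lvs_indep sc C" "lvs_span sc C = W" "card C = lvs_dim sc W"
    using obtain_basis[OF W] .
  ultimately show ?thesis using indep_card_le[of C B] span_superset[of B] assms(3) by auto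
qed

lemma dim_insert:
  assumes W: "lvs_subspace sc W" and x: "x \<notin> W"
  shows "lvs_dim sc (lvs_span sc (insert x W)) = Suc (lvs_dim sc W)"
proof -
  obtain B where B: "finite B" "lvs_indep sc B" "lvs_span sc B = W" "card B = lvs_dim sc W"
    using obtain_basis[OF W] .
  have "lvs_span sc (insert x W) = lvs_span sc (insert x B)"
  proof
    have "W \<subseteq> lvs_span sc (insert x B)" using B(3) span_mono[of B "insert x B"] by blast
    then show "lvs_span sc (insert x W) \<subseteq> lvs_span sc (insert x B)"
      using span_superset[of "insert x B"] by (simp add: span_subset_iff)
    show "lvs_span sc (insert x B) \<subseteq> lvs_span sc (insert x W)"
      using B(3) span_superset[of B] by (intro span_mono) auto
  qed
  moreover have "x \<notin> B" using B(3) x span_superset[of B] by blast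
  then have "card (insert x B) = Suc (card B)" using B(1) by simp
  ultimately show ?thesis using dim_eq[OF has_dim_span[of "insert x B"]] indep_insert B x by simp
qed

lemma subspace_eq_if_dim:
  assumes U: "lvs_subspace sc U" and W: "lvs_subspace sc W" and "U \<subseteq> W"
    and "lvs_dim sc W \<le> lvs_dim sc U"
  shows "U = W"
proof (rule ccontr)
  assume "U \<noteq> W"
  then obtain x where x: "x \<in> W" "x \<notin> U" using assms(3) by blast
  have "lvs_span sc (insert x U) \<subseteq> W" using x assms(3) by (intro span_least[OF W]) auto
  then have "Suc (lvs_dim sc U) \<le> lvs_dim sc W"
    using dim_mono[OF subspace_span W, of "insert x U"] dim_insert[OF U x(2)] by simp
  then show False using assms(4) by simp
qed

text \<open>Adding a vector of U - W to W raises the dimensions of W and of U \<inter> W by one and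
  leaves the sum with U unchanged. The process ends when U \<subseteq> W, where the formula is
  trivial.\<close>

lemma dim_modular:
  assumes U: "lvs_subspace sc U" and W: "lvs_subspace sc W"
  shows "lvs_dim sc (lvs_span sc (U \<union> W)) + lvs_dim sc (U \<inter> W) = lvs_dim sc U + lvs_dim sc W"
  using W
proof (induction "n - lvs_dim sc W" arbitrary: W rule: less_induct)
  case less
  note W = less.prems
  show ?case
  proof (cases "U \<subseteq> W")
    case True
    then show ?thesis using span_subspace[OF W] by (simp add: Un_absorb1 Int_absorb2)
  next
    case False
    then obtain x where x: "x \<in> U" "x \<notin> W" by blast
    let ?W = "lvs_span sc (insert x W)"
    have W': "lvs_subspace sc ?W" by (rule subspace_span)
    have dW: "lvs_dim sc ?W = Suc (lvs_dim sc W)" using dim_insert[OF W x(2)] .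
    have "lvs_dim sc ?W \<le> n"
      using dim_mono[OF W' subspace_UNIV] dim_eq[OF dim_UNIV] by simp
    then have IH: "lvs_dim sc (lvs_span sc (U \<union> ?W)) + lvs_dim sc (U \<inter> ?W) = lvs_dim sc U + lvs_dim sc ?W"
      using less.hyps[OF _ W'] dW by simp
    have "U \<inter> ?W = lvs_span sc (insert x (U \<inter> W))"
    proof
      show "lvs_span sc (insert x (U \<inter> W)) \<subseteq> U \<inter> ?W"
        using x U W' span_superset[of "insert x W"] by (intro span_least subspace_Int) auto
    next
      show "U \<inter> ?W \<subseteq> lvs_span sc (insert x (U \<inter> W))"
      proof
        fix u assume u: "u \<in> U \<inter> ?W"
        then obtain k where "u - sc k x \<in> W"
          using span_insert_iff[of u x W] span_subspace[OF W] by auto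
        moreover have "u - sc k x \<in> U" using u x U subspace_diff subspace_scale by blast
        ultimately show "u \<in> lvs_span sc (insert x (U \<inter> W))"
          using span_insert_iff[of u x "U \<inter> W"] span_superset[of "U \<inter> W"] by blast
      qed
    qed
    then have "lvs_dim sc (U \<inter> ?W) = Suc (lvs_dim sc (U \<inter> W))"
      using dim_insert[OF subspace_Int[OF U W]] x by simp
    moreover have "lvs_span sc (U \<union> ?W) = lvs_span sc (U \<union> W)"
    proof (intro subset_antisym)
      have "?W \<subseteq> lvs_span sc (U \<union> W)" using x by (intro span_mono) auto
      then show "lvs_span sc (U \<union> ?W) \<subseteq> lvs_span sc (U \<union> W)"
        using span_superset[of "U \<union> W"] by (auto simp: span_subset_iff)
      show "lvs_span sc (U \<union> W) \<subseteq> lvs_span sc (U \<union> ?W)"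
        using span_superset[of "insert x W"] by (intro span_mono) auto
    qed
    ultimately show ?thesis using IH dW by simp
  qed
qed

section \<open>The subspaces as a ranked modular lattice\<close>

sublocale ranked_modular_lattice "{W. lvs_subspace sc W}" "(\<subseteq>)" "(\<inter>)"
  "\<lambda>U W. lvs_span sc (U \<union> W)" "\<lambda>W. int (lvs_dim sc W)"
proof (standard, goal_cases)
  case (7 x y)
  then show ?case using span_superset by blast
next
  case (8 x y)
  then show ?case using span_superset by blast
next
  case (10 x y z)
  then show ?case by (simp add: span_least)
next
  case (12 x y)
  then show ?case using subspace_eq_if_dim by simp
next
  case (13 x y)
  then show ?case using dim_modular[of x y] by simp
qed (auto simp: subspace_Int subspace_span dim_mono)

lemma lub_eq_sum:
  assumes "lub P A u" "\<And>i. i \<in> A \<Longrightarrow> lvs_subspace sc (P i)"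
  shows "lvs_sum sc (P ` A) = u"
proof (rule subset_antisym)
  show "lvs_sum sc (P ` A) \<subseteq> u"
    unfolding lvs_sum_def using assms by (intro span_least) (auto simp: lub_def)
  have "\<forall>i\<in>A. P i \<subseteq> lvs_sum sc (P ` A)" unfolding lvs_sum_def using span_superset by fast
  then show "u \<subseteq> lvs_sum sc (P ` A)" using assms by (simp add: lub_def lvs_sum_def subspace_span)
qed

lemma dim_span_le_card:
  assumes "finite S"
  shows "lvs_dim sc (lvs_span sc S) \<le> card S"
proof -
  obtain B where "finite B" "lvs_indep sc B" "lvs_span sc B = lvs_span sc S"
    "card B = lvs_dim sc (lvs_span sc S)"
    using obtain_basis[OF subspace_span] .
  then show ?thesis using indep_card_le[OF assms, of B] span_superset[of B] by simp
qed

text \<open>A redundant vector could be dropped, leaving a spanning set smaller than the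
  dimension.\<close>

lemma indep_if_card_le_dim:
  assumes "finite S" "card S \<le> lvs_dim sc (lvs_span sc S)"
  shows "lvs_indep sc S"
  unfolding indep_iff
proof (intro ballI notI)
  fix v assume v: "v \<in> S" "v \<in> lvs_span sc (S - {v})"
  then have "S \<subseteq> lvs_span sc (S - {v})" using span_superset[of "S - {v}"] by blast
  then have "lvs_span sc S = lvs_span sc (S - {v})"
    using span_mono[of "S - {v}" S] by (simp add: span_subset_iff subset_antisym)
  then have "lvs_dim sc (lvs_span sc S) \<le> card (S - {v})" using dim_span_le_card[of "S - {v}"] assms by simp
  then show False using assms(2) card_Diff1_less[OF assms(1) v(1)] by linarith
qed

lemma dual_lub_eq_Inter:
  assumes "ranked_modular_lattice.lub {W. lvs_subspace sc W} (\<lambda>x y. y \<subseteq> x) P A u"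
    and "\<And>i. i \<in> A \<Longrightarrow> lvs_subspace sc (P i)"
  shows "\<Inter>(P ` A) = u"
proof -
  interpret D: ranked_modular_lattice "{W. lvs_subspace sc W}" "\<lambda>x y. y \<subseteq> x"
    "\<lambda>U W. lvs_span sc (U \<union> W)" "(\<inter>)" "\<lambda>W. - int (lvs_dim sc W)"
    by (rule dual)
  have u: "u \<in> {W. lvs_subspace sc W}" "\<forall>i\<in>A. u \<subseteq> P i"
    "\<forall>w\<in>{W. lvs_subspace sc W}. (\<forall>i\<in>A. w \<subseteq> P i) \<longrightarrow> w \<subseteq> u"
    using assms(1)[unfolded D.lub_def] by simp_all
  have "lvs_subspace sc (\<Inter>(P ` A))" using assms(2) by (intro subspace_Inter) auto
  then have "\<Inter>(P ` A) \<subseteq> u" using u(3) by (simp add: INF_lower)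
  then show ?thesis using u(2) by auto
qed

lemma has_dim_iff:
  assumes "lvs_subspace sc W"
  shows "lvs_has_dim sc W d \<longleftrightarrow> lvs_dim sc W = d"
  using dim_eq[of W d] has_dim_dim[OF assms] by blast

lemma grass_dim: "S \<in> grass sc k \<longleftrightarrow> lvs_subspace sc S \<and> lvs_dim sc S = k"
  unfolding grass_def using has_dim_iff[of S k] by blast

lemma isometric_embedding_isometric:
  assumes "isometric_embedding sc k l m f"
  shows "isometric l m (int k) f"
  unfolding isometric_def
proof (intro conjI ballI)
  show "f A \<in> {W. lvs_subspace sc W}" if "A \<in> johnson_vertices l m" for A
    using that assms(1) grass_dim[of "f A" k] unfolding isometric_embedding_def by blast
next
  fix A B assume AB: "A \<in> johnson_vertices l m" "B \<in> johnson_vertices l m"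
  have S: "f A \<in> grass sc k" "f B \<in> grass sc k" using AB assms(1) unfolding isometric_embedding_def by blast+
  have d: "k - lvs_dim sc (f A \<inter> f B) = m - card (A \<inter> B)"
    using AB assms(1) johnson_dist_eq[OF AB] unfolding isometric_embedding_def grass_dist_def by simp
  \<comment> \<open>Both sides of \<open>d\<close> are truncated differences; bounding the dimension
    by k and the cardinality by m turns \<open>d\<close> into an equation of integers.\<close>
  have "lvs_dim sc (f A \<inter> f B) \<le> k"
    using S dim_mono[of "f A \<inter> f B" "f A"] by (auto simp: grass_dim subspace_Int)
  moreover have "card (A \<inter> B) \<le> m"
    using johnson_verticesD[OF AB(1)] card_mono[of A "A \<inter> B"] by auto
  ultimately show "int (lvs_dim sc (f A \<inter> f B)) = int k - int m + int (card (A \<inter> B))"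
    using d by linarith
qed

text \<open>The theorem speaks of sets of points or hyperplanes, the lattice results of sets of
  indices. Injectivity identifies them; \<open>h\<close> will be a sum or an intersection.\<close>

lemma image_subsets:
  assumes "inj_on P {0..<l}"
  shows "{h \<Y> | \<Y>. \<Y> \<subseteq> P ` {0..<l} \<and> card \<Y> = m} = (\<lambda>A. h (P ` A)) ` johnson_vertices l m"
proof (intro subset_antisym subsetI)
  fix S assume "S \<in> {h \<Y> | \<Y>. \<Y> \<subseteq> P ` {0..<l} \<and> card \<Y> = m}"
  then obtain \<Y> where Y: "S = h \<Y>" "\<Y> \<subseteq> P ` {0..<l}" "card \<Y> = m" by blast
  then obtain A where A: "A \<subseteq> {0..<l}" "\<Y> = P ` A" by (auto simp: subset_image_iff)
  moreover from A have "card A = m" using Y(3) card_image[OF inj_on_subset[OF assms A(1)]] by simp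
  ultimately show "S \<in> (\<lambda>A. h (P ` A)) ` johnson_vertices l m"
    using Y(1) by (auto simp: johnson_vertices_def)
next
  fix S assume "S \<in> (\<lambda>A. h (P ` A)) ` johnson_vertices l m"
  then obtain A where A: "S = h (P ` A)" "A \<subseteq> {0..<l}" "card A = m"
    by (auto simp: johnson_vertices_def)
  then have "card (P ` A) = m" using card_image[OF inj_on_subset[OF assms A(2)]] by simp
  then show "S \<in> {h \<Y> | \<Y>. \<Y> \<subseteq> P ` {0..<l} \<and> card \<Y> = m}" using A by blast
qed

lemma star_points:
  assumes iso: "isometric l (Suc p) (int k) g" and star: "star_triples_meet l p g"
    and l: "2 * Suc p \<le> l" and k: "Suc p \<le> k"
  obtains M P where "lvs_subspace sc M" "lvs_dim sc M = k - Suc p" "inj_on P {0..<l}"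
    "\<forall>i<l. P i \<in> grass sc (k - Suc p + 1) \<and> M \<subseteq> P i"
    "\<forall>A\<in>johnson_vertices l (Suc p). lvs_sum sc (P ` A) = g A"
    "\<forall>T\<subseteq>{0..<l}. card T = 2 * Suc p \<longrightarrow> lvs_sum sc (P ` T) \<in> grass sc (k + Suc p)"
proof -
  from star_structure[OF iso star l, unfolded mem_Collect_eq] obtain M P
    where M: "lvs_subspace sc M" "int (lvs_dim sc M) = int k - int (Suc p)"
      and P': "\<forall>i<l. lvs_subspace sc (P i) \<and> M \<subseteq> P i \<and> int (lvs_dim sc (P i)) = int k - int p"
      and lub': "\<forall>A\<in>johnson_vertices l (Suc p). lub P A (g A)"
    by blast
  note P = P'[rule_format] and lub = bspec[OF lub']
  have sub: "lvs_subspace sc (P i)" if "i \<in> A" "A \<subseteq> {0..<l}" for i A using P that by auto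
  show ?thesis
  proof (rule that[of M P])
    show "inj_on P {0..<l}" using isometric_lub_inj[OF iso _ lub] l by auto
    show "lvs_dim sc M = k - Suc p" using M(2) k by linarith
    show "\<forall>i<l. P i \<in> grass sc (k - Suc p + 1) \<and> M \<subseteq> P i"
    proof (intro allI impI)
      fix i assume "i < l"
      from P[OF this] show "P i \<in> grass sc (k - Suc p + 1) \<and> M \<subseteq> P i"
        using k unfolding grass_dim by auto
    qed
    have "lvs_sum sc (P ` A) = g A" if "A \<in> johnson_vertices l (Suc p)" for A
      using lub_eq_sum[OF lub[OF that]] sub johnson_verticesD(1)[OF that] by blast
    then show "\<forall>A\<in>johnson_vertices l (Suc p). lvs_sum sc (P ` A) = g A" by blast
    have "lvs_sum sc (P ` T) \<in> grass sc (k + Suc p)" if T: "T \<subseteq> {0..<l}" "card T = 2 * Suc p" for T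
    proof -
      have "P ` {0..<l} \<subseteq> {W. lvs_subspace sc W}" using P by auto
      from isometric_lub_rk[OF iso this lub T]
      obtain u where u: "lub P T u" "int (lvs_dim sc u) = int k + int (Suc p)" by blast
      have "lvs_sum sc (P ` T) = u" using lub_eq_sum[OF u(1)] sub T(1) by blast
      then show ?thesis using u unfolding grass_dim lub_def by auto
    qed
    then show "\<forall>T\<subseteq>{0..<l}. card T = 2 * Suc p \<longrightarrow> lvs_sum sc (P ` T) \<in> grass sc (k + Suc p)" by blast
  qed (rule M(1))
qed

text \<open>The lattice results are applied to reverse inclusion with rank - dim. The element of
  least rank is then a subspace N of dimension k + (p + 1), the points over it are its hyperplanes,
  and least upper bounds are intersections.\<close>

lemma costar_hyperplanes:
  assumes iso: "isometric l (Suc p) (int k) g"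
    and star: "ranked_modular_lattice.star_triples_meet (\<lambda>x y. y \<subseteq> x)
      (\<lambda>U W. lvs_span sc (U \<union> W)) l p g"
    and l: "2 * Suc p \<le> l" and k: "Suc p \<le> k"
  obtains N P where "lvs_subspace sc N" "lvs_dim sc N = k + Suc p" "inj_on P {0..<l}"
    "\<forall>i<l. P i \<in> grass sc (k + Suc p - 1) \<and> P i \<subseteq> N"
    "\<forall>A\<in>johnson_vertices l (Suc p). \<Inter>(P ` A) = g A"
    "\<forall>T\<subseteq>{0..<l}. card T = 2 * Suc p \<longrightarrow> \<Inter>(P ` T) \<in> grass sc (k - Suc p)"
proof -
  interpret D: ranked_modular_lattice "{W. lvs_subspace sc W}" "\<lambda>x y. y \<subseteq> x"
    "\<lambda>U W. lvs_span sc (U \<union> W)" "(\<inter>)" "\<lambda>W. - int (lvs_dim sc W)"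
    by (rule dual)
  have iso': "D.isometric l (Suc p) (- int k) g" by (rule isometric_dual[OF iso])
  from D.star_structure[OF iso' star l, unfolded mem_Collect_eq] obtain N P
    where N: "lvs_subspace sc N" "- int (lvs_dim sc N) = - int k - int (Suc p)"
      and P': "\<forall>i<l. lvs_subspace sc (P i) \<and> P i \<subseteq> N \<and> - int (lvs_dim sc (P i)) = - int k - int p"
      and lub': "\<forall>A\<in>johnson_vertices l (Suc p). D.lub P A (g A)"
    by blast
  note P = P'[rule_format] and lub = bspec[OF lub']
  have sub: "lvs_subspace sc (P i)" if "i \<in> A" "A \<subseteq> {0..<l}" for i A using P that by auto
  show ?thesis
  proof (rule that[of N P])
    show "inj_on P {0..<l}" using D.isometric_lub_inj[OF iso' _ lub] l by auto
    show "lvs_dim sc N = k + Suc p" using N(2) by linarith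
    show "\<forall>i<l. P i \<in> grass sc (k + Suc p - 1) \<and> P i \<subseteq> N"
    proof (intro allI impI)
      fix i assume "i < l"
      from P[OF this] show "P i \<in> grass sc (k + Suc p - 1) \<and> P i \<subseteq> N"
        unfolding grass_dim by auto
    qed
    have "\<Inter>(P ` A) = g A" if "A \<in> johnson_vertices l (Suc p)" for A
      using dual_lub_eq_Inter[OF lub[OF that]] sub johnson_verticesD(1)[OF that] by blast
    then show "\<forall>A\<in>johnson_vertices l (Suc p). \<Inter>(P ` A) = g A" by blast
    have "\<Inter>(P ` T) \<in> grass sc (k - Suc p)" if T: "T \<subseteq> {0..<l}" "card T = 2 * Suc p" for T
    proof -
      have "P ` {0..<l} \<subseteq> {W. lvs_subspace sc W}" using P by auto
      from D.isometric_lub_rk[OF iso' this lub T]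
      obtain u where u: "D.lub P T u" "- int (lvs_dim sc u) = - int k + int (Suc p)" by blast
      have "\<Inter>(P ` T) = u" using dual_lub_eq_Inter[OF u(1)] sub T(1) by blast
      then show ?thesis using u unfolding grass_dim D.lub_def by auto
    qed
    then show "\<forall>T\<subseteq>{0..<l}. card T = 2 * Suc p \<longrightarrow> \<Inter>(P ` T) \<in> grass sc (k - Suc p)" by blast
  qed (rule N(1))
qed

text \<open>A basis of M together with one vector outside M from each point spans N. It has at most
  (k - m) + 2m vectors, and dim N = k + m, so it is independent and extends to a base of V.\<close>

lemma apartment:
  assumes M: "lvs_subspace sc M" "lvs_dim sc M = k - m" and "m \<le> k" and "0 < m"
    and P: "\<And>i. i < 2 * m \<Longrightarrow> P i \<in> grass sc (k - m + 1) \<and> M \<subseteq> P i"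
    and N: "lvs_sum sc (P ` {0..<2 * m}) \<in> grass sc (k + m)"
  shows "\<exists>M N B. lvs_subspace sc M \<and> lvs_has_dim sc M (k - m) \<and>
             lvs_subspace sc N \<and> lvs_has_dim sc N (k + m) \<and>
             lvs_basis sc UNIV B \<and>
             (\<exists>BM\<subseteq>B. M = lvs_span sc BM) \<and> (\<exists>BN\<subseteq>B. N = lvs_span sc BN) \<and>
             (\<lambda>A. lvs_sum sc (P ` A)) ` johnson_vertices (2 * m) m =
               {S. \<exists>C\<subseteq>B. S = lvs_span sc C \<and> S \<in> grass sc k \<and> M \<subseteq> S \<and> S \<subseteq> N}"
proof -
  let ?I = "{0..<2 * m}"
  obtain BM where BM: "finite BM" "lvs_indep sc BM" "lvs_span sc BM = M" "card BM = k - m"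
    using obtain_basis[OF M(1)] M(2) by metis
  have "\<exists>v. v \<in> P i \<and> v \<notin> M" if "i < 2 * m" for i
  proof -
    have "P i \<noteq> M" using P[OF that] M(2) unfolding grass_dim by auto
    then show ?thesis using P[OF that] by blast
  qed
  then obtain v where v: "\<And>i. i < 2 * m \<Longrightarrow> v i \<in> P i" "\<And>i. i < 2 * m \<Longrightarrow> v i \<notin> M" by metis
  have P_span: "P i = lvs_span sc (insert (v i) BM)" if i: "i < 2 * m" for i
  proof -
    have Pi: "lvs_subspace sc (P i)" "lvs_dim sc (P i) = k - m + 1" "M \<subseteq> P i"
      using P[OF i] unfolding grass_dim by auto
    have "v i \<notin> BM" using v(2)[OF i] BM(3) span_superset[of BM] by blast
    then have "lvs_dim sc (lvs_span sc (insert (v i) BM)) = k - m + 1"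
      using dim_eq[OF has_dim_span[OF indep_insert[OF BM(2), of "v i"]]] v(2)[OF i] BM by simp
    moreover have "lvs_span sc (insert (v i) BM) \<subseteq> P i"
      using v(1)[OF i] Pi(3) BM(3) span_superset[of BM] by (intro span_least[OF Pi(1)]) auto
    ultimately show ?thesis using subspace_eq_if_dim[OF subspace_span Pi(1), symmetric] Pi(2) by simp
  qed
  have sum_span: "lvs_sum sc (P ` A) = lvs_span sc (BM \<union> v ` A)" if A: "A \<subseteq> ?I" "A \<noteq> {}" for A
  proof
    have "P i \<subseteq> lvs_span sc (BM \<union> v ` A)" if "i \<in> A" for i
    proof -
      have "i < 2 * m" "insert (v i) BM \<subseteq> BM \<union> v ` A" using that A(1) by auto
      then show ?thesis using P_span[of i] span_mono by simp
    qed
    then show "lvs_sum sc (P ` A) \<subseteq> lvs_span sc (BM \<union> v ` A)"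
      unfolding lvs_sum_def by (intro span_least[OF subspace_span]) auto
    have "BM \<union> v ` A \<subseteq> \<Union>(P ` A)"
    proof
      fix x assume "x \<in> BM \<union> v ` A"
      then obtain i where "i \<in> A" "x \<in> insert (v i) BM" using A(2) by auto
      moreover from this have "i < 2 * m" using A(1) by auto
      ultimately have "x \<in> P i" using P_span span_superset[of "insert (v i) BM"] by blast
      then show "x \<in> \<Union>(P ` A)" using \<open>i \<in> A\<close> by blast
    qed
    then show "lvs_span sc (BM \<union> v ` A) \<subseteq> lvs_sum sc (P ` A)"
      unfolding lvs_sum_def by (rule span_mono)
  qed
  let ?C = "BM \<union> v ` ?I"
  define N where "N = lvs_span sc ?C"
  have I: "?I \<noteq> {}" using \<open>0 < m\<close> by simp
  have N': "lvs_subspace sc N" "lvs_dim sc N = k + m"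
    using N sum_span[OF subset_refl I] unfolding grass_dim N_def by simp_all
  have fin: "finite ?C" using BM by simp
  have le: "card ?C \<le> card BM + card (v ` ?I)" "card (v ` ?I) \<le> 2 * m"
    using card_Un_le card_image_le[of ?I v] by auto
  have ge: "k + m \<le> card ?C" using dim_span_le_card[OF fin] N'(2) unfolding N_def by simp
  have card_C: "card ?C = k + m" "card (v ` ?I) = 2 * m" using le ge BM(4) \<open>m \<le> k\<close> by linarith+
  have inj: "inj_on v ?I" using card_C(2) by (intro eq_card_imp_inj_on) auto
  have disj: "BM \<inter> v ` ?I = {}"
    using card_Un_Int[OF BM(1), of "v ` ?I"] card_C BM \<open>m \<le> k\<close> by simp
  have ind: "lvs_indep sc ?C" using indep_if_card_le_dim[OF fin] card_C N' unfolding N_def by simp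
  have card_part: "card (BM \<union> v ` A) = k - m + card A" if "A \<subseteq> ?I" for A
  proof -
    have "BM \<inter> v ` A = {}" using disj that by blast
    then have "card (BM \<union> v ` A) = card BM + card (v ` A)"
      using BM(1) finite_subset[OF that] by (intro card_Un_disjoint) auto
    then show ?thesis using card_image[OF inj_on_subset[OF inj that]] BM by simp
  qed
  obtain B where B: "?C \<subseteq> B" "finite B" "lvs_basis sc UNIV B"
    using basis_extend[OF subspace_UNIV ind fin] by auto
  have B_ind: "lvs_indep sc B" using B unfolding lvs_basis_def by blast
  have "(\<lambda>A. lvs_sum sc (P ` A)) ` johnson_vertices (2 * m) m =
      {S. \<exists>C\<subseteq>B. S = lvs_span sc C \<and> S \<in> grass sc k \<and> M \<subseteq> S \<and> S \<subseteq> N}" (is "?J = ?S")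
  proof (intro subset_antisym subsetI)
    fix S assume "S \<in> ?J"
    then obtain A where S: "S = lvs_sum sc (P ` A)" and "A \<in> johnson_vertices (2 * m) m" by blast
    then have A: "A \<subseteq> ?I" "card A = m" using johnson_verticesD(1,2) by blast+
    then have "A \<noteq> {}" using \<open>0 < m\<close> by auto
    let ?D = "BM \<union> v ` A"
    have D: "?D \<subseteq> ?C" "finite ?D" using A(1) BM finite_subset[OF A(1)] by auto
    have S': "S = lvs_span sc ?D" using sum_span[OF A(1) \<open>A \<noteq> {}\<close>] S by simp
    have "lvs_has_dim sc S k"
      using has_dim_span[OF indep_mono[OF ind D(1)] D(2)] card_part[OF A(1)] A(2) \<open>m \<le> k\<close> S' by simp
    then have "S \<in> grass sc k" using S' subspace_span unfolding grass_def by simp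
    moreover have "M \<subseteq> S" unfolding S' BM(3)[symmetric] by (intro span_mono) auto
    moreover have "S \<subseteq> N" unfolding S' N_def using D(1) by (rule span_mono)
    moreover have "?D \<subseteq> B" using D(1) B(1) by (rule subset_trans)
    ultimately show "S \<in> ?S" using S' by (intro CollectI exI[of _ ?D]) simp
  next
    fix S assume "S \<in> ?S"
    then obtain D where D: "D \<subseteq> B" "S = lvs_span sc D" "S \<in> grass sc k" "M \<subseteq> S" "S \<subseteq> N" by blast
    \<comment> \<open>Independence of \<open>B\<close> lifts M \<subseteq> S \<subseteq> N to the
      generating sets: BM \<subseteq> D \<subseteq> \<open>?C\<close>. So D consists of BM and some
      of the vectors v i, and |D| = k leaves exactly m of them.\<close>
    have "BM \<subseteq> D"
    proof
      fix x assume x: "x \<in> BM"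
      then have "x \<in> M" using span_superset[of BM] unfolding BM(3) by (rule subsetD[rotated])
      then have "x \<in> lvs_span sc D" using D(4) unfolding D(2) by (rule subsetD[rotated])
      moreover have "x \<in> B" using x B(1) by blast
      ultimately show "x \<in> D" using indep_span_mem[OF B_ind D(1)] by simp
    qed
    moreover have "D \<subseteq> ?C"
    proof
      fix x assume x: "x \<in> D"
      then have "x \<in> S" using span_superset[of D] unfolding D(2) by (rule subsetD[rotated])
      then have "x \<in> lvs_span sc ?C" using D(5) unfolding N_def by (rule subsetD[rotated])
      moreover have "x \<in> B" using x D(1) by (rule subsetD[rotated])
      ultimately show "x \<in> ?C" using indep_span_mem[OF B_ind B(1)] by blast
    qed
    moreover define A where "A = {i \<in> ?I. v i \<in> D}"
    ultimately have D_eq: "D = BM \<union> v ` A" by auto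
    have A: "A \<subseteq> ?I" unfolding A_def by auto
    have "lvs_has_dim sc S (card D)"
      using has_dim_span[OF indep_mono[OF B_ind D(1)]] finite_subset[OF D(1) B(2)] D(2) by simp
    moreover have "lvs_has_dim sc S k" using D(3) by (simp add: grass_def)
    ultimately have "card D = k" by (rule has_dim_unique)
    then have cA: "card A = m" using card_part[OF A] D_eq \<open>m \<le> k\<close> by simp
    then have "A \<noteq> {}" using \<open>0 < m\<close> by auto
    then have "S = lvs_sum sc (P ` A)" using sum_span[OF A] D_eq D(2) by simp
    then show "S \<in> ?J" using johnson_verticesI[OF A cA] by (rule image_eqI)
  qed
  moreover have "\<exists>BM\<subseteq>B. M = lvs_span sc BM" using B(1) BM(3) by (intro exI[of _ BM]) simp
  moreover have "\<exists>BN\<subseteq>B. N = lvs_span sc BN" using B(1) N_def by (intro exI[of _ ?C]) simp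
  moreover have "lvs_has_dim sc M (k - m)" using M has_dim_iff[OF M(1)] by simp
  moreover have "lvs_has_dim sc N (k + m)" using N'(2) has_dim_iff[OF N'(1)] by simp
  ultimately show ?thesis using M(1) N'(1) B(3) by (intro exI[of _ M] exI[of _ N] exI[of _ B]) simp
qed

end

section \<open>Reduction to m' and conclusion\<close>

lemma complement_image:
  assumes "m \<le> l"
  shows "(\<lambda>A. {0..<l} - A) ` johnson_vertices l (l - m) = johnson_vertices l m"
proof -
  have V: "{0..<l} - A \<in> johnson_vertices l (l - q)" if "A \<in> johnson_vertices l q" for A q
    using johnson_verticesD[OF that] by (intro johnson_verticesI) (auto simp: card_Diff_subset)
  show ?thesis
  proof (intro subset_antisym subsetI)
    fix A assume A: "A \<in> johnson_vertices l m"
    have "A = {0..<l} - ({0..<l} - A)" using johnson_verticesD(1)[OF A] by blast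
    then show "A \<in> (\<lambda>A. {0..<l} - A) ` johnson_vertices l (l - m)" using V[OF A] by (rule image_eqI)
  qed (use V[of _ "l - m"] assms in auto)
qed

theorem theorem4:
  fixes sc :: "'r::division_ring \<Rightarrow> 'v::ab_group_add \<Rightarrow> 'v"
    and n k l m :: nat
    and f :: "nat set \<Rightarrow> 'v set"
  assumes vs: "left_vector_space sc"
    and dimV: "lvs_has_dim sc UNIV n"
    and n4: "4 \<le> n" and l4: "4 \<le> l"
    and k_bounds: "1 < k" "k < n - 1"
    and m_bounds: "1 < m" "m < l - 1"
    and m'_le: "min m (l - m) \<le> min k (n - k)"
    and emb: "isometric_embedding sc k l m f"
  shows
    "(let m' = min m (l - m); \<J> = f ` johnson_vertices l m in
       ((\<exists>M \<X>. lvs_subspace sc M \<and> lvs_has_dim sc M (k - m') \<and>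
           \<X> \<subseteq> {S \<in> grass sc (k - m' + 1). M \<subseteq> S} \<and> card \<X> = l \<and>
           points_t_indep sc M (2 * m') \<X> \<and>
           \<J> = {lvs_sum sc \<Y> | \<Y>. \<Y> \<subseteq> \<X> \<and> card \<Y> = m'})
        \<or>
        (\<exists>N \<Y>. lvs_subspace sc N \<and> lvs_has_dim sc N (k + m') \<and>
           \<Y> \<subseteq> {S \<in> grass sc (k + m' - 1). S \<subseteq> N} \<and> card \<Y> = l \<and>
           hyperplanes_t_indep sc N (2 * m') \<Y> \<and>
           \<J> = {\<Inter>\<Z> | \<Z>. \<Z> \<subseteq> \<Y> \<and> card \<Z> = m'}))
       \<and>
       (l = 2 * m \<longrightarrow>
          (\<exists>M N B. lvs_subspace sc M \<and> lvs_has_dim sc M (k - m) \<and>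
             lvs_subspace sc N \<and> lvs_has_dim sc N (k + m) \<and>
             lvs_basis sc UNIV B \<and>
             (\<exists>BM\<subseteq>B. M = lvs_span sc BM) \<and> (\<exists>BN\<subseteq>B. N = lvs_span sc BN) \<and>
             \<J> = {S. \<exists>C\<subseteq>B. S = lvs_span sc C \<and> S \<in> grass sc k \<and> M \<subseteq> S \<and> S \<subseteq> N})))"
proof -
  interpret finite_left_space sc n
    by unfold_locales (rule vs, rule dimV)
  define m' where "m' = min m (l - m)"
  have m': "2 \<le> m'" "2 * m' \<le> l" "m' \<le> k" "m' \<le> l"
    using m_bounds m'_le unfolding m'_def by linarith+
  have iso_f: "isometric l m (int k) f" by (rule isometric_embedding_isometric[OF emb])
  let ?c = "\<lambda>A. {0..<l} - A"
  \<comment> \<open>Either \<open>f\<close> itself or its composition with complementation is taken,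
    so that the index sets fill at most half of the ground set; the image stays the same.\<close>
  have "\<exists>g. isometric l m' (int k) g \<and> g ` johnson_vertices l m' = f ` johnson_vertices l m"
  proof (cases "m \<le> l - m")
    case True
    then have "m' = m" by (simp add: m'_def)
    then show ?thesis using iso_f by blast
  next
    case False
    then have "m' = l - m" by (simp add: m'_def)
    moreover have "(\<lambda>A. f (?c A)) ` johnson_vertices l (l - m) = f ` johnson_vertices l m"
      unfolding image_image[of f ?c, symmetric] using complement_image[of m l] m_bounds by simp
    ultimately show ?thesis
      using isometric_complement[OF iso_f] m_bounds by (intro exI[of _ "\<lambda>A. f (?c A)"]) simp
  qed
  then obtain g where iso: "isometric l m' (int k) g"
    and g: "g ` johnson_vertices l m' = f ` johnson_vertices l m" by blast
  \<comment> \<open>The dichotomy picks an element of a set with m' - 1 = p + 1 elements, which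
    needs m' \<ge> 2.\<close>
  obtain p where p: "m' = Suc (Suc p)" using m'(1) by (metis add_2_eq_Suc le_Suc_ex)
  note iso = iso[unfolded p] and l = m'(2)[unfolded p] and k = m'(3)[unfolded p]
  define J where "J = f ` johnson_vertices l m"
  let ?star = "\<exists>M \<X>. lvs_subspace sc M \<and> lvs_has_dim sc M (k - m') \<and>
           \<X> \<subseteq> {S \<in> grass sc (k - m' + 1). M \<subseteq> S} \<and> card \<X> = l \<and>
           points_t_indep sc M (2 * m') \<X> \<and>
           J = {lvs_sum sc \<Y> | \<Y>. \<Y> \<subseteq> \<X> \<and> card \<Y> = m'}"
  let ?costar = "\<exists>N \<Y>. lvs_subspace sc N \<and> lvs_has_dim sc N (k + m') \<and>
           \<Y> \<subseteq> {S \<in> grass sc (k + m' - 1). S \<subseteq> N} \<and> card \<Y> = l \<and>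
           hyperplanes_t_indep sc N (2 * m') \<Y> \<and>
           J = {\<Inter>\<Z> | \<Z>. \<Z> \<subseteq> \<Y> \<and> card \<Z> = m'}"
  let ?apartment = "\<exists>M N B. lvs_subspace sc M \<and> lvs_has_dim sc M (k - m) \<and>
             lvs_subspace sc N \<and> lvs_has_dim sc N (k + m) \<and>
             lvs_basis sc UNIV B \<and>
             (\<exists>BM\<subseteq>B. M = lvs_span sc BM) \<and> (\<exists>BN\<subseteq>B. N = lvs_span sc BN) \<and>
             J = {S. \<exists>C\<subseteq>B. S = lvs_span sc C \<and> S \<in> grass sc k \<and> M \<subseteq> S \<and> S \<subseteq> N}"
  \<comment> \<open>Stated for every \<open>h\<close> with image \<open>J\<close>, since besides
    \<open>g\<close> also its composition with complementation is inserted.\<close>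
  have star: "?star \<and> (l = 2 * m \<longrightarrow> ?apartment)"
    if iso_h: "isometric l (Suc (Suc p)) (int k) h" and star_h: "star_triples_meet l (Suc p) h"
      and h: "h ` johnson_vertices l m' = J" for h
  proof -
    obtain M P where M: "lvs_subspace sc M" "lvs_dim sc M = k - m'" and inj: "inj_on P {0..<l}"
      and P': "\<forall>i<l. P i \<in> grass sc (k - m' + 1) \<and> M \<subseteq> P i"
      and sum: "\<forall>A\<in>johnson_vertices l m'. lvs_sum sc (P ` A) = h A"
      and indep': "\<forall>T\<subseteq>{0..<l}. card T = 2 * m' \<longrightarrow> lvs_sum sc (P ` T) \<in> grass sc (k + m')"
      unfolding p by (rule star_points[OF iso_h star_h l k])
    note P = P'[rule_format] and indep = indep'[rule_format]
    have J: "J = (\<lambda>A. lvs_sum sc (P ` A)) ` johnson_vertices l m'"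
      unfolding h[symmetric] using sum by (intro image_cong) auto
    have "points_t_indep sc M (2 * m') (P ` {0..<l})"
      unfolding points_t_indep_def
    proof (intro allI impI)
      fix Y assume Y: "Y \<subseteq> P ` {0..<l}" "card Y = 2 * m'"
      then obtain T where T: "T \<subseteq> {0..<l}" "Y = P ` T" by (auto simp: subset_image_iff)
      then have "card T = 2 * m'" using Y card_image[OF inj_on_subset[OF inj T(1)]] by simp
      then have "lvs_has_dim sc (lvs_sum sc Y) (k + m')" using indep[OF T(1)] T(2) unfolding grass_def by simp
      moreover have "k + m' = lvs_dim sc M + 2 * m'" using M(2) m'(3) by simp
      ultimately show "lvs_has_dim sc (lvs_sum sc Y) (lvs_dim sc M + 2 * m')" by simp
    qed
    moreover have "P ` {0..<l} \<subseteq> {S \<in> grass sc (k - m' + 1). M \<subseteq> S}"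
      by (intro image_subsetI CollectI P) simp
    moreover have "card (P ` {0..<l}) = l" using card_image[OF inj] by simp
    moreover have "lvs_has_dim sc M (k - m')" using M(2) has_dim_iff[OF M(1)] by simp
    moreover have "J = {lvs_sum sc \<Y> | \<Y>. \<Y> \<subseteq> P ` {0..<l} \<and> card \<Y> = m'}"
      unfolding image_subsets[OF inj] by (rule J)
    ultimately have ?star using M(1) by (intro exI[of _ M] exI[of _ "P ` {0..<l}"]) simp
    moreover have ?apartment if "l = 2 * m"
    proof -
      have m: "m' = m" using that by (simp add: m'_def)
      show ?thesis
        unfolding J m that
      proof (rule apartment[OF M[unfolded m]])
        show "P i \<in> grass sc (k - m + 1) \<and> M \<subseteq> P i" if "i < 2 * m" for i
          using P[of i] that \<open>l = 2 * m\<close> unfolding m by simp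
        show "lvs_sum sc (P ` {0..<2 * m}) \<in> grass sc (k + m)"
          using indep[of "{0..<2 * m}"] \<open>l = 2 * m\<close> unfolding m by simp
      qed (use m m'(3) m_bounds in simp_all)
    qed
    ultimately show ?thesis by blast
  qed
  have costar: "?costar"
    if star_g: "ranked_modular_lattice.star_triples_meet (\<lambda>x y. y \<subseteq> x)
      (\<lambda>U W. lvs_span sc (U \<union> W)) l (Suc p) g"
  proof -
    obtain N P where N: "lvs_subspace sc N" "lvs_dim sc N = k + m'" and inj: "inj_on P {0..<l}"
      and P': "\<forall>i<l. P i \<in> grass sc (k + m' - 1) \<and> P i \<subseteq> N"
      and Int: "\<forall>A\<in>johnson_vertices l m'. \<Inter>(P ` A) = g A"
      and indep': "\<forall>T\<subseteq>{0..<l}. card T = 2 * m' \<longrightarrow> \<Inter>(P ` T) \<in> grass sc (k - m')"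
      unfolding p by (rule costar_hyperplanes[OF iso star_g l k])
    note P = P'[rule_format] and indep = indep'[rule_format]
    have J: "J = (\<lambda>A. \<Inter>(P ` A)) ` johnson_vertices l m'"
      unfolding J_def g[symmetric] using Int by (intro image_cong) auto
    have "hyperplanes_t_indep sc N (2 * m') (P ` {0..<l})"
      unfolding hyperplanes_t_indep_def
    proof (intro allI impI)
      fix Y assume Y: "Y \<subseteq> P ` {0..<l}" "card Y = 2 * m'"
      then obtain T where T: "T \<subseteq> {0..<l}" "Y = P ` T" by (auto simp: subset_image_iff)
      then have "card T = 2 * m'" using Y card_image[OF inj_on_subset[OF inj T(1)]] by simp
      then have "lvs_has_dim sc (\<Inter>Y) (k - m')" using indep[OF T(1)] T(2) unfolding grass_def by simp
      moreover have "k - m' = lvs_dim sc N - 2 * m'" using N(2) by simp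
      ultimately show "lvs_has_dim sc (\<Inter>Y) (lvs_dim sc N - 2 * m')" by simp
    qed
    moreover have "P ` {0..<l} \<subseteq> {S \<in> grass sc (k + m' - 1). S \<subseteq> N}"
      by (intro image_subsetI CollectI P) simp
    moreover have "card (P ` {0..<l}) = l" using card_image[OF inj] by simp
    moreover have "lvs_has_dim sc N (k + m')" using N(2) has_dim_iff[OF N(1)] by simp
    moreover have "J = {\<Inter>\<Z> | \<Z>. \<Z> \<subseteq> P ` {0..<l} \<and> card \<Z> = m'}"
      unfolding image_subsets[OF inj] by (rule J)
    ultimately show ?thesis using N(1) by (intro exI[of _ N] exI[of _ "P ` {0..<l}"]) simp
  qed
  have "(?star \<or> ?costar) \<and> (l = 2 * m \<longrightarrow> ?apartment)"
    using star_or_costar[OF iso l]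
  proof (elim disjE conjE)
    assume "star_triples_meet l (Suc p) g"
    then show ?thesis using star[OF iso _ g[folded J_def]] by blast
  next
    assume "ranked_modular_lattice.star_triples_meet (\<lambda>x y. y \<subseteq> x)
      (\<lambda>U W. lvs_span sc (U \<union> W)) l (Suc p) g"
      and top: "top_triples_meet l (Suc (Suc (Suc p))) g"
    from costar[OF this(1)] have ?costar .
    moreover have ?apartment if l2: "l = 2 * m"
    proof -
      have m: "m' = m" "l - m' = m'" using l2 by (simp_all add: m'_def)
      \<comment> \<open>Complementation is an automorphism of J(2m, m) that turns top triples into star triples.\<close>
      have iso_c: "isometric l (Suc (Suc p)) (int k) (\<lambda>A. g (?c A))"
        using isometric_complement[OF iso] m(2) m'(4) unfolding p by simp
      have "star_triples_meet l (Suc p) (\<lambda>A. g (?c A))"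
        unfolding star_triples_meet_def
      proof (intro ballI impI)
        fix X a b c
        assume X: "X \<in> johnson_vertices l (Suc p)" and a: "a \<in> {0..<l} - X" and b: "b \<in> {0..<l} - X"
          and c: "c \<in> {0..<l} - X" and ne: "a \<noteq> b" "a \<noteq> c" "b \<noteq> c"
        \<comment> \<open>As l = 2m, the complement of an (m - 1)-set has m + 1 elements, and
          enlarging the set by i removes i from its complement.\<close>
        have "card (?c X) = Suc (Suc (Suc p))"
          using johnson_verticesD[OF X] l2 m p by (simp add: card_Diff_subset)
        then have Z: "?c X \<in> johnson_vertices l (Suc (Suc (Suc p)))" by (intro johnson_verticesI) auto
        have "?c (insert i X) = ?c X - {i}" for i by auto
        then show "g (?c (insert a X)) \<inter> g (?c (insert b X)) \<subseteq> g (?c (insert c X))"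
          using top Z a b c ne unfolding top_triples_meet_def by simp
      qed
      moreover have "(\<lambda>A. g (?c A)) ` johnson_vertices l m' = J"
        unfolding image_image[of g ?c, symmetric] J_def
        using complement_image[of m' l] m(2) m'(4) g by simp
      ultimately show ?thesis using star[OF iso_c] l2 by blast
    qed
    ultimately show ?thesis by blast
  qed
  then show ?thesis unfolding Let_def m'_def[symmetric] J_def[symmetric] .
qed

end
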